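(* Let $d\in\mathbb{N}$ and $\kappa\in(0,\infty)$. There exist a compact convex set $\Omega\subset\mathbb{R}^d$ with non-empty interior and a probability measure $\rho\in\mathcal{P}(\Omega)$ such that the problem $$\inf\Big\{\int_\Omega\mathrm{HK}_\kappa^2(\delta_x,\nu)\,d\rho(x)\;\Big|\;\nu\in\mathcal{M}_+(\Omega)\Big\}$$ has no discrete optimizer.
   Context: $\mathcal{M}_+(\Omega)$ and $\mathcal{P}(\Omega)$ denote the non-negative Radon measures and probability measures on $\Omega$. A measure is called discrete if it is an at most countable sum of weighted Dirac measures. For $\mu,\nu\in\mathcal{M}_+(\Omega)$ the Hellinger--Kantorovich distance is $$\mathrm{HK}_\kappa^2(\mu,\nu) := \inf_{\gamma\in\mathcal{M}_+(\Omega\times\Omega)} \int \hat c_\kappa\,d\gamma + \mathrm{KL}(P_1\gamma|\mu)+\mathrm{KL}(P_2\gamma|\nu),$$ where $P_1\gamma,P_2\gamma$ are the two marginals of $\gamma$, $\hat c_\kappa(x,y) = -2\log\cos(|x-y|/\kappa)$ if $|x-y|\le\kappa\pi/2$ (with $-\log 0=+\infty$) and $+\infty$ otherwise, and $\mathrm{KL}(\mu|\nu)=\int\varphi(d\mu/d\nu)\,d\nu$ if $\mu\ll\nu$, $\mu\ge0$, and $+\infty$ otherwise, with $\varphi(s)=s\log s-s+1$ for $s>0$, $\varphi(0)=1$. With $\mathrm{Cos}(s):=\cos(\min\{|s|,\pi/2\})$ one has $\mathrm{HK}_\kappa^2(\delta_x,\nu)=1+\nu(\Omega)-2\sqrt{\int_\Omega\mathrm{Cos}^2(|x-y|/\kappa)\,d\nu(y)}$.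 *)

theory Defs
  imports "HOL-Probability.Probability"
begin

text \<open>
  Measures on a set \<open>\<Omega>\<close> are measures on the Borel sigma-algebra of the subspace \<open>\<Omega>\<close>,
  that is, on \<open>restrict_space borel \<Omega>\<close>.
  A Radon measure is a Borel measure that is finite on compact sets and inner regular.
  On a compact \<open>\<Omega>\<close> these measures are automatically finite.
\<close>

definition radon_measures :: "'a::topological_space set \<Rightarrow> 'a measure set" where
  "radon_measures \<Omega> = {M. sets M = sets (restrict_space borel \<Omega>) \<and>
     (\<forall>K. compact K \<and> K \<subseteq> \<Omega> \<longrightarrow> emeasure M K < \<infinity>) \<and>
     (\<forall>B\<in>sets M. emeasure M B = (SUP K\<in>{K. K \<subseteq> B \<and> compact K}. emeasure M K))}"

definition prob_measures :: "'a::topological_space set \<Rightarrow> 'a measure set" where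
  "prob_measures \<Omega> = {M \<in> radon_measures \<Omega>. prob_space M}"

definition dirac :: "'a::topological_space set \<Rightarrow> 'a \<Rightarrow> 'a measure" where
  "dirac \<Omega> x = return (restrict_space borel \<Omega>) x"

text \<open>
  The integral over \<open>count_space S\<close> is the sum over the (finite or countably infinite) set \<open>S\<close>.
\<close>

definition discrete_measure :: "'a::topological_space set \<Rightarrow> 'a measure \<Rightarrow> bool" where
  "discrete_measure \<Omega> M \<longleftrightarrow> (\<exists>S w. countable S \<and> S \<subseteq> \<Omega> \<and>
     (\<forall>A\<in>sets M. emeasure M A = (\<integral>\<^sup>+ a. w a * emeasure (dirac \<Omega> a) A \<partial>count_space S)))"

definition kl_phi :: "real \<Rightarrow> real" where
  "kl_phi s = (if s = 0 then 1 else s * ln s - s + 1)"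

text \<open>
  \<open>KL_div \<mu> \<nu>\<close> is \<open>KL(\<mu>|\<nu>)\<close>. In the library the reference measure comes first:
  \<open>absolutely_continuous \<nu> \<mu>\<close> means \<open>\<mu> \<lless> \<nu>\<close>, and \<open>RN_deriv \<nu> \<mu>\<close> is \<open>d\<mu>/d\<nu>\<close>, which is
  \<open>\<nu>\<close>-almost everywhere finite for the finite measures considered here.
  Since \<open>kl_phi\<close> is non-negative on \<open>{0..}\<close>, the embedding into \<open>ennreal\<close> loses nothing.
\<close>

definition KL_div :: "'a measure \<Rightarrow> 'a measure \<Rightarrow> ennreal" where
  "KL_div \<mu> \<nu> = (if absolutely_continuous \<nu> \<mu>
     then \<integral>\<^sup>+ x. ennreal (kl_phi (enn2real (RN_deriv \<nu> \<mu> x))) \<partial>\<nu> else \<infinity>)"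

text \<open>
  The inequality is strict because at distance \<open>\<kappa> * pi / 2\<close> the cosine vanishes and the
  convention \<open>-log 0 = \<infinity>\<close> applies, whereas \<open>ln 0 = 0\<close> in the library.
\<close>

definition hk_cost :: "real \<Rightarrow> 'a::metric_space \<Rightarrow> 'a \<Rightarrow> ennreal" where
  "hk_cost \<kappa> x y = (if dist x y < \<kappa> * pi / 2 then ennreal (- 2 * ln (cos (dist x y / \<kappa>))) else \<infinity>)"

text \<open>The squared Hellinger--Kantorovich distance.\<close>

definition HK_sq ::
  "'a::metric_space set \<Rightarrow> real \<Rightarrow> 'a measure \<Rightarrow> 'a measure \<Rightarrow> ennreal" where
  "HK_sq \<Omega> \<kappa> \<mu> \<nu> = (INF \<gamma>\<in>radon_measures (\<Omega> \<times> \<Omega>).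
     (\<integral>\<^sup>+ z. hk_cost \<kappa> (fst z) (snd z) \<partial>\<gamma>)
     + KL_div (distr \<gamma> (restrict_space borel \<Omega>) fst) \<mu>
     + KL_div (distr \<gamma> (restrict_space borel \<Omega>) snd) \<nu>)"

definition hk_objective ::
  "'a::metric_space set \<Rightarrow> real \<Rightarrow> 'a measure \<Rightarrow> 'a measure \<Rightarrow> ennreal" where
  "hk_objective \<Omega> \<kappa> \<rho> \<nu> = (\<integral>\<^sup>+ x. HK_sq \<Omega> \<kappa> (dirac \<Omega> x) \<nu> \<partial>\<rho>)"

definition hk_optimizer ::
  "'a::metric_space set \<Rightarrow> real \<Rightarrow> 'a measure \<Rightarrow> 'a measure \<Rightarrow> bool" where
  "hk_optimizer \<Omega> \<kappa> \<rho> \<nu> \<longleftrightarrow> \<nu> \<in> radon_measures \<Omega> \<and>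
     hk_objective \<Omega> \<kappa> \<rho> \<nu> = (INF \<nu>'\<in>radon_measures \<Omega>. hk_objective \<Omega> \<kappa> \<rho> \<nu>')"

end

theory Submission
  imports Defs
begin

text \<open>
  For a Dirac measure, Fenchel--Young duality gives
  \<open>HK_sq \<Omega> \<kappa> (dirac \<Omega> x) \<nu> = 1 + \<nu>(\<Omega>) - 2 * sqrt (K \<nu> x)\<close> with \<open>K \<nu> x = \<integral> Cos\<^sup>2(|x - y| / \<kappa>) d\<nu>(y)\<close>.
  Take for \<open>\<Omega>\<close> a ball of radius \<open>\<kappa> * (1 + pi / 2)\<close>, let \<open>\<nu>\<^sub>0\<close> be a multiple of the length measure on
  a diameter's middle part \<open>[- \<kappa>, \<kappa>]\<close>, put \<open>u = sqrt (K \<nu>\<^sub>0)\<close> and let \<open>\<rho>\<close> have density \<open>u / C\<close> on the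
  diameter, where \<open>C\<close> is the one-dimensional integral of \<open>Cos\<^sup>2\<close> and the multiple is chosen such
  that \<open>u\<close> has integral \<open>C\<close>. Since \<open>2 * u * sqrt (K \<nu>) \<le> u\<^sup>2 + K \<nu>\<close> and \<open>K \<nu>\<close> has integral at most
  \<open>C * \<nu>(\<Omega>)\<close> along the diameter, \<open>\<nu>\<^sub>0\<close> is optimal, and for every optimal \<open>\<nu>\<close> the projection \<open>P\<close> of
  \<open>\<nu>\<close> to the diameter satisfies \<open>Cos\<^sup>2 * P = Cos\<^sup>2 * \<nu>\<^sub>0\<close> almost everywhere.
  The second derivative of \<open>Cos\<^sup>2\<close> jumps at \<open>pi / 2\<close>, so an atom of \<open>P\<close> would be visible in a third
  difference of \<open>Cos\<^sup>2 * P\<close>, whereas \<open>Cos\<^sup>2 * \<nu>\<^sub>0\<close> shows none. Hence an optimal \<open>\<nu>\<close> has no atoms; if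
  discrete, it would vanish.
\<close>

section \<open>The distance to a Dirac measure\<close>

text \<open>Finite Borel measures on a Polish space are inner regular. The theorem
  \<open>inner_regular\<close> speaks of measures on \<open>borel\<close>, so \<open>M\<close> is
  first pushed forward along the inclusion, which changes no value on Borel subsets of
  \<open>\<Omega>\<close>.\<close>

lemma radon_measuresI:
  fixes \<Omega> :: "'a::{second_countable_topology, complete_space} set"
  assumes "closed \<Omega>" and sets: "sets M = sets (restrict_space borel \<Omega>)" and "finite_measure M"
  shows "M \<in> radon_measures \<Omega>"
proof -
  interpret finite_measure M by fact
  have \<Omega>: "\<Omega> \<in> sets borel" using \<open>closed \<Omega>\<close> by simp
  have space: "space M = \<Omega>"
    using sets_eq_imp_space_eq[OF sets] by (simp add: space_restrict_space)
  have id: "(\<lambda>x. x) \<in> measurable M borel"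
    using measurable_cong_sets[OF sets refl] measurable_restrict_space1[of "\<lambda>x. x" borel borel \<Omega>]
    by auto
  let ?N = "distr M borel (\<lambda>x. x)"
  have N: "emeasure ?N A = emeasure M A" if "A \<in> sets borel" "A \<subseteq> \<Omega>" for A
    using that id space by (subst emeasure_distr) (auto intro!: arg_cong[where f="emeasure M"])
  have fin: "emeasure ?N (space ?N) \<noteq> \<infinity>"
    using id by (simp add: emeasure_distr)
  have "emeasure M B = (SUP K\<in>{K. K \<subseteq> B \<and> compact K}. emeasure M K)" if "B \<in> sets M" for B
  proof -
    have B: "B \<in> sets borel" "B \<subseteq> \<Omega>"
      using that \<Omega> by (auto simp: sets sets_restrict_space_iff)
    have "emeasure M B = emeasure ?N B" using N B by simp
    also have "\<dots> = (SUP K\<in>{K. K \<subseteq> B \<and> compact K}. emeasure ?N K)"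
      by (rule inner_regular) (use fin B in auto)
    also have "\<dots> = (SUP K\<in>{K. K \<subseteq> B \<and> compact K}. emeasure M K)"
      using B by (intro SUP_cong refl N) (auto intro: borel_compact)
    finally show ?thesis .
  qed
  then show ?thesis
    using sets by (auto simp: radon_measures_def less_top[symmetric])
qed

lemma radon_measuresD:
  assumes "compact \<Omega>" "M \<in> radon_measures \<Omega>"
  shows "sets M = sets (restrict_space borel \<Omega>)" "space M = \<Omega>" "finite_measure M"
proof -
  show *: "sets M = sets (restrict_space borel \<Omega>)"
    using assms by (simp add: radon_measures_def)
  show sp: "space M = \<Omega>"
    using sets_eq_imp_space_eq[OF *] by (simp add: space_restrict_space)
  have "emeasure M \<Omega> < \<infinity>" using assms by (auto simp: radon_measures_def)
  then show "finite_measure M" by (intro finite_measureI) (simp add: sp)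
qed

text \<open>This is \<open>Cos\<^sup>2(|x - y| / \<kappa>) = exp (- hk_cost \<kappa> x y)\<close>.\<close>

definition hk_kernel :: "real \<Rightarrow> 'a::metric_space \<Rightarrow> 'a \<Rightarrow> real" where
  "hk_kernel \<kappa> x y = (if dist x y < \<kappa> * pi / 2 then (cos (dist x y / \<kappa>))\<^sup>2 else 0)"

lemma hk_kernel_bounds: "0 \<le> hk_kernel \<kappa> x y" "hk_kernel \<kappa> x y \<le> 1"
  by (auto simp: hk_kernel_def power_le_one abs_square_le_1)

lemma measurable_hk_kernel [measurable]:
  fixes f g :: "'b \<Rightarrow> 'a::{second_countable_topology, metric_space}"
  assumes [measurable]: "f \<in> borel_measurable M" "g \<in> borel_measurable M"
  shows "(\<lambda>x. hk_kernel \<kappa> (f x) (g x)) \<in> borel_measurable M"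
  unfolding hk_kernel_def by measurable

lemma measurable_hk_cost [measurable]:
  fixes f g :: "'b \<Rightarrow> 'a::{second_countable_topology, metric_space}"
  assumes [measurable]: "f \<in> borel_measurable M" "g \<in> borel_measurable M"
  shows "(\<lambda>x. hk_cost \<kappa> (f x) (g x)) \<in> borel_measurable M"
  unfolding hk_cost_def by measurable

lemma measurable_kl_phi [measurable]: "kl_phi \<in> borel_measurable borel"
  unfolding kl_phi_def by measurable

lemma kl_phi_nonneg:
  assumes "0 \<le> s"
  shows "0 \<le> kl_phi s"
proof (cases "s = 0")
  case False
  then have "0 < s" using assms by simp
  have "- ln s \<le> 1 / s - 1"
    using ln_le_minus_one[of "1 / s"] \<open>0 < s\<close> by (simp add: ln_div)
  then have "s * (- ln s) \<le> s * (1 / s - 1)"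
    using \<open>0 < s\<close> by (intro mult_left_mono) auto
  then show ?thesis using \<open>0 < s\<close> by (simp add: kl_phi_def algebra_simps)
qed (simp add: kl_phi_def)

lemma hk_cost_eq:
  assumes "\<kappa> > 0"
  shows "hk_cost \<kappa> x y = (if hk_kernel \<kappa> x y = 0 then \<infinity> else ennreal (- ln (hk_kernel \<kappa> x y)))"
proof (cases "dist x y < \<kappa> * pi / 2")
  case True
  have "dist x y / \<kappa> < pi / 2" "- (pi / 2) < dist x y / \<kappa>" "0 \<le> dist x y / \<kappa>"
    using True assms by (auto simp: field_simps intro: less_le_trans[of _ 0])
  then have "0 < cos (dist x y / \<kappa>)" by (intro cos_gt_zero_pi) auto
  then show ?thesis using True
    by (auto simp: hk_cost_def hk_kernel_def ln_realpow)
qed (auto simp: hk_cost_def hk_kernel_def)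

text \<open>This is the Fenchel--Young inequality: the convex conjugate of \<open>kl_phi\<close> is
  \<open>exp p - 1\<close>, taken at \<open>p = ln q\<close>. It reduces to
  \<open>ln z \<le> z - 1\<close> at \<open>z = q / r\<close>.\<close>

lemma kl_phi_young:
  assumes "0 \<le> r" "0 < q"
  shows "1 + r * ln q \<le> kl_phi r + q"
proof (cases "r = 0")
  case True then show ?thesis using assms by (simp add: kl_phi_def)
next
  case False
  then have r: "0 < r" using assms by simp
  have "ln (q / r) \<le> q / r - 1" using ln_le_minus_one r assms by simp
  then have "r * ln (q / r) \<le> r * (q / r - 1)" using r by (intro mult_left_mono) auto
  then show ?thesis using r assms by (simp add: kl_phi_def ln_div algebra_simps)
qed

text \<open>
  The multiplier \<open>ln u\<close> appears as the pair \<open>ennreal (ln u)\<close>, \<open>ennreal (- ln u)\<close> on opposite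
  sides because \<open>ennreal\<close> truncates negative numbers to \<open>0\<close>.
\<close>

lemma hk_young:
  assumes "\<kappa> > 0" "u > 0" "d \<noteq> \<infinity>"
  shows "1 + d * ennreal (- ln u)
    \<le> ennreal (kl_phi (enn2real d)) + d * hk_cost \<kappa> x y + d * ennreal (ln u)
       + ennreal (hk_kernel \<kappa> x y / u)"
proof -
  obtain r where r: "d = ennreal r" "0 \<le> r" using \<open>d \<noteq> \<infinity>\<close> by (cases d) auto
  define K where "K = hk_kernel \<kappa> x y"
  have K: "0 \<le> K" "K \<le> 1" using hk_kernel_bounds by (auto simp: K_def)
  have phi: "0 \<le> kl_phi r" using r by (simp add: kl_phi_nonneg)
  consider "K = 0" "r = 0" | "K = 0" "r > 0" | "K > 0" using K r by fastforce
  then show ?thesis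
  proof cases
    case 1
    then show ?thesis by (simp add: r K_def[symmetric] kl_phi_def)
  next
    case 2
    then have "d * hk_cost \<kappa> x y = \<infinity>"
      by (simp add: r hk_cost_eq[OF \<open>\<kappa> > 0\<close>] K_def[symmetric] ennreal_mult_top)
    then show ?thesis by simp
  next
    case 3
    have l: "ln K \<le> 0" using 3 K by simp
    \<comment> \<open>The choice \<open>q = K / u\<close> splits \<open>ln q\<close> into minus the
      cost and minus the multiplier \<open>ln u\<close>.\<close>
    have "1 + r * ln (K / u) \<le> kl_phi r + K / u"
      using kl_phi_young[of r "K / u"] r 3 \<open>u > 0\<close> by simp
    then have *: "1 + r * max 0 (- ln u) \<le> kl_phi r + r * (- ln K) + r * max 0 (ln u) + K / u"
      using 3 \<open>u > 0\<close> by (auto simp: ln_div max_def algebra_simps)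
    have e: "ennreal (max 0 z) = ennreal z" for z by (simp add: max_def ennreal_neg)
    have "1 + d * ennreal (- ln u) = ennreal (1 + r * max 0 (- ln u))"
      using r by (simp add: ennreal_plus ennreal_mult e)
    also have "\<dots> \<le> ennreal (kl_phi r + r * (- ln K) + r * max 0 (ln u) + K / u)"
      using * by (rule ennreal_leI)
    also have "\<dots> = ennreal (kl_phi r) + ennreal r * ennreal (- ln K) + ennreal r * ennreal (ln u) + ennreal (K / u)"
    proof -
      have "0 \<le> r * (- ln K)"
        by (rule mult_nonneg_nonneg) (use r l in auto)
      moreover have "0 \<le> r * max 0 (ln u)" "0 \<le> K / u"
        using r K \<open>u > 0\<close> by auto
      ultimately have nonneg: "0 \<le> r * (- ln K)" "0 \<le> r * max 0 (ln u)" "0 \<le> K / u" .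
      have "ennreal (r * (- ln K)) = ennreal r * ennreal (- ln K)"
        by (rule ennreal_mult) (use r l in auto)
      moreover have "ennreal (r * max 0 (ln u)) = ennreal r * ennreal (ln u)"
        using ennreal_mult[of r "max 0 (ln u)"] r by (simp add: e)
      ultimately
      show ?thesis
        using phi nonneg by (simp only: ennreal_plus add_nonneg_nonneg)
    qed
    finally show ?thesis using 3 r
      by (simp add: hk_cost_eq[OF \<open>\<kappa> > 0\<close>] K_def[symmetric])
  qed
qed

lemma prob_space_dirac: "x \<in> \<Omega> \<Longrightarrow> prob_space (dirac \<Omega> x)"
  unfolding dirac_def by (rule prob_space_return) (simp add: space_restrict_space)

lemma sets_dirac [simp]: "sets (dirac \<Omega> x) = sets (restrict_space borel \<Omega>)"
  by (simp add: dirac_def)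

lemma space_dirac [simp]: "space (dirac \<Omega> x) = \<Omega>"
  by (simp add: dirac_def space_restrict_space)

lemma nn_integral_dirac:
  assumes "x \<in> \<Omega>" "g \<in> borel_measurable (restrict_space borel \<Omega>)"
  shows "(\<integral>\<^sup>+ y. g y \<partial>dirac \<Omega> x) = g x"
  unfolding dirac_def using assms by (intro nn_integral_return) (auto simp: space_restrict_space)

text \<open>Absolute continuity makes \<open>M\<close> a multiple of the Dirac measure, so the
  density at \<open>x\<close> is the total mass of \<open>M\<close>, and integration against the
  Dirac measure evaluates at \<open>x\<close>.\<close>

lemma KL_div_dirac:
  assumes x: "x \<in> \<Omega>" and sets: "sets M = sets (restrict_space borel \<Omega>)"
    and ac: "absolutely_continuous (dirac \<Omega> x) M"
  shows "KL_div M (dirac \<Omega> x) = ennreal (kl_phi (measure M \<Omega>))"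
proof -
  interpret D: prob_space "dirac \<Omega> x" using x by (rule prob_space_dirac)
  let ?D = "RN_deriv (dirac \<Omega> x) M"
  have m: "?D \<in> borel_measurable (restrict_space borel \<Omega>)"
    using borel_measurable_RN_deriv[of "dirac \<Omega> x" M]
    by (simp add: measurable_cong_sets[OF sets_dirac refl])
  have "density (dirac \<Omega> x) ?D = M"
    using ac sets by (intro D.density_RN_deriv) auto
  then have "emeasure M \<Omega> = emeasure (density (dirac \<Omega> x) ?D) \<Omega>" by simp
  also have "\<dots> = (\<integral>\<^sup>+ y. ?D y * indicator \<Omega> y \<partial>dirac \<Omega> x)"
    by (rule emeasure_density) (use sets.top[of "dirac \<Omega> x"] in auto)
  also have "\<dots> = (\<integral>\<^sup>+ y. ?D y \<partial>dirac \<Omega> x)"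
    by (intro nn_integral_cong) simp
  also have "\<dots> = ?D x"
    using x m by (rule nn_integral_dirac)
  finally have e: "emeasure M \<Omega> = ?D x" .
  have [measurable]: "(\<lambda>y. ennreal (kl_phi (enn2real (?D y)))) \<in> borel_measurable (restrict_space borel \<Omega>)"
    using m by measurable
  have "(\<integral>\<^sup>+ y. ennreal (kl_phi (enn2real (?D y))) \<partial>dirac \<Omega> x) = ennreal (kl_phi (enn2real (?D x)))"
    by (rule nn_integral_dirac[OF x]) measurable
  then show ?thesis using ac by (simp add: KL_div_def e[symmetric] measure_def)
qed

lemma measurable_restrict_ident:
  "sets M = sets (restrict_space borel \<Omega>) \<Longrightarrow> (\<lambda>x. x) \<in> measurable M borel"
  using measurable_cong_sets[of M "restrict_space borel \<Omega>" borel borel]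
    measurable_restrict_space1[of "\<lambda>x. x" borel borel \<Omega>] by auto

lemma ennreal_le_add_cancel:
  fixes a b k :: ennreal
  assumes "a + k \<le> b + k" "k \<noteq> \<infinity>"
  shows "a \<le> b"
  using assms ennreal_add_left_cancel_le[of k a b] by (simp add: add.commute)

text \<open>Weak duality with dual parameter \<open>u\<close>. For every plan,
  \<open>hk_young\<close> is integrated against \<open>\<nu>\<close> with \<open>d\<close> the
  density of the second marginal, and \<open>kl_phi_young\<close> is applied to the total mass
  \<open>m\<close> of the plan; the terms in \<open>m * ln u\<close> cancel in the sum.\<close>

lemma HK_sq_dirac_ge:
  fixes \<Omega> :: "'a::{second_countable_topology, complete_space} set"
  assumes \<kappa>: "\<kappa> > 0" and \<Omega>: "compact \<Omega>" and x: "x \<in> \<Omega>" and \<nu>: "\<nu> \<in> radon_measures \<Omega>" and u: "u > 0"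
  shows "1 + emeasure \<nu> \<Omega> \<le> HK_sq \<Omega> \<kappa> (dirac \<Omega> x) \<nu> + ennreal u + (\<integral>\<^sup>+ y. ennreal (hk_kernel \<kappa> x y / u) \<partial>\<nu>)"
proof -
  note \<nu>' = radon_measuresD[OF \<Omega> \<nu>]
  interpret \<nu>: finite_measure \<nu> by fact
  have [measurable]: "(\<lambda>y. y) \<in> borel_measurable \<nu>"
    using \<nu>'(1) by (rule measurable_restrict_ident)
  define I where "I = (\<integral>\<^sup>+ y. ennreal (hk_kernel \<kappa> x y / u) \<partial>\<nu>)"
  have main: "1 + emeasure \<nu> \<Omega> \<le> (\<integral>\<^sup>+ z. hk_cost \<kappa> (fst z) (snd z) \<partial>\<gamma>)
     + KL_div (distr \<gamma> (restrict_space borel \<Omega>) fst) (dirac \<Omega> x)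
     + KL_div (distr \<gamma> (restrict_space borel \<Omega>) snd) \<nu> + (ennreal u + I)"
    if \<gamma>: "\<gamma> \<in> radon_measures (\<Omega> \<times> \<Omega>)" for \<gamma>
  proof -
    note \<gamma>' = radon_measuresD[OF compact_Times[OF \<Omega> \<Omega>] \<gamma>]
    interpret \<gamma>: finite_measure \<gamma> by fact
    have id: "(\<lambda>z. z) \<in> borel_measurable \<gamma>"
      using \<gamma>'(1) by (rule measurable_restrict_ident)
    have mfst: "fst \<in> measurable \<gamma> (restrict_space borel \<Omega>)"
      by (rule measurable_restrict_space2)
         (auto simp: \<gamma>'(2) intro!: measurable_compose[OF id] borel_measurable_continuous_onI continuous_intros)
    have msnd: "snd \<in> measurable \<gamma> (restrict_space borel \<Omega>)"
      by (rule measurable_restrict_space2)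
         (auto simp: \<gamma>'(2) intro!: measurable_compose[OF id] borel_measurable_continuous_onI continuous_intros)
    define P where "P = distr \<gamma> (restrict_space borel \<Omega>) fst"
    define Q where "Q = distr \<gamma> (restrict_space borel \<Omega>) snd"
    define c where "c = (\<integral>\<^sup>+ z. hk_cost \<kappa> (fst z) (snd z) \<partial>\<gamma>)"
    show ?thesis
    proof (cases "absolutely_continuous (dirac \<Omega> x) P \<and> absolutely_continuous \<nu> Q")
      case False
      then have "KL_div P (dirac \<Omega> x) = \<infinity> \<or> KL_div Q \<nu> = \<infinity>"
        by (auto simp: KL_div_def)
      then show ?thesis unfolding P_def Q_def by auto
    next
      case True
      then have acP: "absolutely_continuous (dirac \<Omega> x) P" and acQ: "absolutely_continuous \<nu> Q"
        by auto
      have spP: "space P = \<Omega>" by (simp add: P_def space_restrict_space)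
      define m where "m = measure \<gamma> (space \<gamma>)"
      have mP: "measure P \<Omega> = m"
        unfolding P_def m_def using mfst \<gamma>'(2)
        by (subst measure_distr) (auto simp: sets_restrict_space intro!: arg_cong[where f="measure \<gamma>"])
      have KLP: "KL_div P (dirac \<Omega> x) = ennreal (kl_phi m)"
        using KL_div_dirac[OF x _ acP] mP by (simp add: P_def)
      have Qfin: "finite_measure Q"
        unfolding Q_def using msnd by (rule \<gamma>.finite_measure_distr)
      have sQ: "sets Q = sets \<nu>" by (simp add: Q_def \<nu>'(1))
      define D where "D = RN_deriv \<nu> Q"
      have [measurable]: "D \<in> borel_measurable \<nu>" by (simp add: D_def)
      have Dfin: "AE y in \<nu>. D y \<noteq> \<infinity>"
        unfolding D_def using Qfin acQ sQ
        by (intro \<nu>.RN_deriv_finite) (auto simp: finite_measure_def)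
      have KLQ: "KL_div Q \<nu> = (\<integral>\<^sup>+ y. ennreal (kl_phi (enn2real (D y))) \<partial>\<nu>)"
        using acQ by (simp add: KL_div_def D_def)
      have DQ: "(\<integral>\<^sup>+ y. D y * f y \<partial>\<nu>) = (\<integral>\<^sup>+ y. f y \<partial>Q)" if "f \<in> borel_measurable \<nu>" for f
        unfolding D_def using \<nu>.RN_deriv_nn_integral[OF acQ sQ that] by simp
      have Qm: "emeasure Q \<Omega> = ennreal m"
        unfolding Q_def m_def using msnd \<gamma>'(2)
        by (subst emeasure_distr) (auto simp: sets_restrict_space \<gamma>.emeasure_eq_measure intro!: arg_cong[where f="measure \<gamma>"])
      have spQ: "space Q = \<Omega>" by (simp add: Q_def space_restrict_space)
      have Dc: "(\<integral>\<^sup>+ y. D y * k \<partial>\<nu>) = ennreal m * k" for k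
        by (subst DQ) (auto simp: spQ Qm mult.commute)
      \<comment> \<open>Absolute continuity forces the first marginal to live on \<open>{x}\<close>,
        so the cost becomes an integral over the second marginal alone.\<close>
      have "AE z in P. z = x"
      proof (rule AE_I')
        have s: "\<Omega> - {x} \<in> sets (restrict_space borel \<Omega>)"
          using \<Omega> by (subst sets_restrict_space_iff) (auto intro: borel_compact)
        then have "emeasure (dirac \<Omega> x) (\<Omega> - {x}) = 0"
          unfolding dirac_def by (subst emeasure_return) auto
        then have "\<Omega> - {x} \<in> null_sets (dirac \<Omega> x)"
          using s by (intro null_setsI) auto
        then show "\<Omega> - {x} \<in> null_sets P" using acP unfolding absolutely_continuous_def by blast
      qed (auto simp: spP)
      then have AEx: "AE z in \<gamma>. fst z = x"
        unfolding P_def by (rule AE_distrD[OF mfst])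
      have "c = (\<integral>\<^sup>+ z. hk_cost \<kappa> x (snd z) \<partial>\<gamma>)"
        unfolding c_def using AEx by (intro nn_integral_cong_AE) auto
      also have "\<dots> = (\<integral>\<^sup>+ y. hk_cost \<kappa> x y \<partial>Q)"
        unfolding Q_def using msnd
        by (subst nn_integral_distr) (auto intro!: measurable_restrict_space1 measurable_hk_cost)
      also have "\<dots> = (\<integral>\<^sup>+ y. D y * hk_cost \<kappa> x y \<partial>\<nu>)"
        by (subst DQ) auto
      finally have c: "c = (\<integral>\<^sup>+ y. D y * hk_cost \<kappa> x y \<partial>\<nu>)" .
      have "emeasure \<nu> \<Omega> + ennreal m * ennreal (- ln u) = (\<integral>\<^sup>+ y. 1 + D y * ennreal (- ln u) \<partial>\<nu>)"
        by (subst nn_integral_add) (auto simp: Dc \<nu>'(2))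
      also have "\<dots> \<le> (\<integral>\<^sup>+ y. ennreal (kl_phi (enn2real (D y))) + D y * hk_cost \<kappa> x y + D y * ennreal (ln u)
       + ennreal (hk_kernel \<kappa> x y / u) \<partial>\<nu>)"
        using Dfin hk_young[OF \<kappa> u] by (intro nn_integral_mono_AE) (auto elim!: eventually_mono)
      also have "\<dots> = KL_div Q \<nu> + c + ennreal m * ennreal (ln u) + I"
        unfolding KLQ c I_def Dc[of "ennreal (ln u)", symmetric] by (simp add: nn_integral_add)
      finally have 1: "emeasure \<nu> \<Omega> + ennreal m * ennreal (- ln u) \<le> KL_div Q \<nu> + c + ennreal m * ennreal (ln u) + I" .
      have m0: "0 \<le> m" by (simp add: m_def)
      have "1 + m * ln u \<le> kl_phi m + u" using kl_phi_young[OF m0 u] .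
      then have "1 + m * max 0 (ln u) \<le> kl_phi m + m * max 0 (- ln u) + u"
        by (auto simp: max_def)
      then have "ennreal (1 + m * max 0 (ln u)) \<le> ennreal (kl_phi m + m * max 0 (- ln u) + u)"
        by (rule ennreal_leI)
      moreover have e: "ennreal (max 0 z) = ennreal z" for z by (simp add: max_def ennreal_neg)
      ultimately have 2: "1 + ennreal m * ennreal (ln u) \<le> ennreal (kl_phi m) + ennreal m * ennreal (- ln u) + ennreal u"
        using m0 kl_phi_nonneg[OF m0] u by (simp add: ennreal_plus ennreal_mult e)
      \<comment> \<open>The sum carries both parts of \<open>m * ln u\<close> on both sides; they
        are finite and can therefore be cancelled in \<open>ennreal\<close>.\<close>
      have "(1 + emeasure \<nu> \<Omega>) + (ennreal m * ennreal (ln u) + ennreal m * ennreal (- ln u))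
        \<le> (c + KL_div P (dirac \<Omega> x) + KL_div Q \<nu> + (ennreal u + I)) + (ennreal m * ennreal (ln u) + ennreal m * ennreal (- ln u))"
        using add_mono[OF 1 2] by (simp add: KLP ac_simps)
      moreover have "ennreal m * ennreal (ln u) + ennreal m * ennreal (- ln u) \<noteq> \<infinity>"
        by (simp add: ennreal_mult_eq_top_iff)
      ultimately have "1 + emeasure \<nu> \<Omega> \<le> c + KL_div P (dirac \<Omega> x) + KL_div Q \<nu> + (ennreal u + I)"
        by (rule ennreal_le_add_cancel)
      then show ?thesis by (simp only: c_def P_def Q_def)
    qed
  qed
  \<comment> \<open>The terms free of \<open>\<gamma>\<close> are moved to the left, so that the
    bound passes to the infimum.\<close>
  have "1 + emeasure \<nu> \<Omega> - (ennreal u + I) \<le> HK_sq \<Omega> \<kappa> (dirac \<Omega> x) \<nu>"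
    unfolding HK_sq_def
  proof (rule INF_greatest)
    fix \<gamma> :: "('a \<times> 'a) measure" assume "\<gamma> \<in> radon_measures (\<Omega> \<times> \<Omega>)"
    from main[OF this] show "1 + emeasure \<nu> \<Omega> - (ennreal u + I) \<le> (\<integral>\<^sup>+ z. hk_cost \<kappa> (fst z) (snd z) \<partial>\<gamma>)
     + KL_div (distr \<gamma> (restrict_space borel \<Omega>) fst) (dirac \<Omega> x)
     + KL_div (distr \<gamma> (restrict_space borel \<Omega>) snd) \<nu>"
      by (subst ennreal_minus_le_iff, subst add.commute) (simp add: \<nu>.emeasure_eq_measure)
  qed
  then have "1 + emeasure \<nu> \<Omega> \<le> (ennreal u + I) + HK_sq \<Omega> \<kappa> (dirac \<Omega> x) \<nu>"
    by (subst (asm) ennreal_minus_le_iff) simp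
  then show ?thesis
    by (simp only: I_def[symmetric] ac_simps)
qed

lemma hk_kernel_integrable:
  fixes \<Omega> :: "'a::{second_countable_topology, complete_space} set"
  assumes "compact \<Omega>" "\<nu> \<in> radon_measures \<Omega>"
  shows "integrable \<nu> (hk_kernel \<kappa> x)"
    and "0 \<le> (\<integral>y. hk_kernel \<kappa> x y \<partial>\<nu>)" "(\<integral>y. hk_kernel \<kappa> x y \<partial>\<nu>) \<le> measure \<nu> \<Omega>"
proof -
  note \<nu>' = radon_measuresD[OF assms]
  interpret \<nu>: finite_measure \<nu> by fact
  have [measurable]: "(\<lambda>y. y) \<in> borel_measurable \<nu>"
    using \<nu>'(1) by (rule measurable_restrict_ident)
  show *: "integrable \<nu> (hk_kernel \<kappa> x)"
    by (rule \<nu>.integrable_const_bound[where B=1]) (auto simp: hk_kernel_bounds)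
  show "0 \<le> (\<integral>y. hk_kernel \<kappa> x y \<partial>\<nu>)"
    by (simp add: hk_kernel_bounds)
  have "(\<integral>y. hk_kernel \<kappa> x y \<partial>\<nu>) \<le> (\<integral>y. 1 \<partial>\<nu>)"
    using * by (intro integral_mono) (auto simp: hk_kernel_bounds)
  then show "(\<integral>y. hk_kernel \<kappa> x y \<partial>\<nu>) \<le> measure \<nu> \<Omega>"
    by (simp add: \<nu>'(2))
qed

text \<open>The kernel is at most 1, so its integral \<open>I\<close> is at most the mass of
  \<open>\<nu>\<close>, and the expression is at least \<open>(1 - sqrt I)\<^sup>2\<close>. Hence
  \<open>ennreal\<close> truncates nothing in the closed formula for the distance.\<close>

lemma HK_sq_dirac_nonneg:
  fixes \<Omega> :: "'a::{second_countable_topology, complete_space} set"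
  assumes "compact \<Omega>" "\<nu> \<in> radon_measures \<Omega>"
  shows "0 \<le> 1 + measure \<nu> \<Omega> - 2 * sqrt (\<integral>y. hk_kernel \<kappa> x y \<partial>\<nu>)"
proof -
  define I where "I = (\<integral>y. hk_kernel \<kappa> x y \<partial>\<nu>)"
  have I: "0 \<le> I" "I \<le> measure \<nu> \<Omega>" using hk_kernel_integrable[OF assms] by (auto simp: I_def)
  have "0 \<le> (1 - sqrt I)\<^sup>2" by simp
  then show ?thesis using I unfolding I_def[symmetric] by (simp add: power2_diff)
qed

text \<open>The dual bound is optimized over \<open>u\<close>: \<open>u + I / u\<close> takes its
  minimum \<open>2 * sqrt I\<close> at \<open>u = sqrt I\<close>. For \<open>I = 0\<close> the
  infimum is only approached, as \<open>u\<close> tends to 0.\<close>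

lemma HK_sq_dirac_lower:
  fixes \<Omega> :: "'a::{second_countable_topology, complete_space} set"
  assumes \<kappa>: "\<kappa> > 0" and \<Omega>: "compact \<Omega>" and x: "x \<in> \<Omega>" and \<nu>: "\<nu> \<in> radon_measures \<Omega>"
  shows "ennreal (1 + measure \<nu> \<Omega> - 2 * sqrt (\<integral>y. hk_kernel \<kappa> x y \<partial>\<nu>)) \<le> HK_sq \<Omega> \<kappa> (dirac \<Omega> x) \<nu>"
proof (cases "HK_sq \<Omega> \<kappa> (dirac \<Omega> x) \<nu>")
  case top
  then show ?thesis by simp
next
  case (real h)
  interpret \<nu>: finite_measure \<nu> using radon_measuresD[OF \<Omega> \<nu>] by simp
  define I where "I = (\<integral>y. hk_kernel \<kappa> x y \<partial>\<nu>)"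
  have I: "0 \<le> I" using hk_kernel_integrable[OF \<Omega> \<nu>] by (simp add: I_def)
  have *: "1 + measure \<nu> \<Omega> \<le> h + u + I / u" if u: "u > 0" for u
  proof -
    have "integrable \<nu> (\<lambda>y. hk_kernel \<kappa> x y / u)" using hk_kernel_integrable[OF \<Omega> \<nu>] by simp
    then have "(\<integral>\<^sup>+ y. ennreal (hk_kernel \<kappa> x y / u) \<partial>\<nu>) = ennreal (I / u)"
      using u by (subst nn_integral_eq_integral) (auto simp: hk_kernel_bounds I_def)
    moreover have "1 + emeasure \<nu> \<Omega> = ennreal (1 + measure \<nu> \<Omega>)"
      by (simp add: \<nu>.emeasure_eq_measure)
    ultimately have "ennreal (1 + measure \<nu> \<Omega>) \<le> ennreal h + ennreal u + ennreal (I / u)"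
      using HK_sq_dirac_ge[OF \<kappa> \<Omega> x \<nu> u] real by simp
    also have "\<dots> = ennreal (h + u + I / u)"
      using real u I by simp
    finally show ?thesis using real u I by (subst (asm) ennreal_le_iff) auto
  qed
  have "1 + measure \<nu> \<Omega> - 2 * sqrt I \<le> h"
  proof (cases "I = 0")
    case True
    have "1 + measure \<nu> \<Omega> - 2 * sqrt I \<le> h + e" if "0 < e" for e
      using *[OF that] True by simp
    then show ?thesis by (rule field_le_epsilon)
  next
    case False
    then have "0 < sqrt I" using I by simp
    from *[OF this] real_div_sqrt[OF I] show ?thesis by linarith
  qed
  then show ?thesis using real by (simp add: I_def ennreal_leI)
qed

text \<open>Equality in Young's inequality asks for \<open>r = q = K / u\<close>, where
  \<open>u = sqrt I\<close> is the optimal dual parameter. This dictates the plan: its first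
  coordinate is \<open>x\<close> and its second marginal has density \<open>K / sqrt I\<close> with
  respect to \<open>\<nu>\<close>.\<close>

lemma HK_sq_dirac_upper:
  fixes \<Omega> :: "'a::{second_countable_topology, complete_space} set"
  assumes \<kappa>: "\<kappa> > 0" and \<Omega>: "compact \<Omega>" and x: "x \<in> \<Omega>" and \<nu>: "\<nu> \<in> radon_measures \<Omega>"
  shows "HK_sq \<Omega> \<kappa> (dirac \<Omega> x) \<nu> \<le> ennreal (1 + measure \<nu> \<Omega> - 2 * sqrt (\<integral>y. hk_kernel \<kappa> x y \<partial>\<nu>))"
proof -
  note \<nu>' = radon_measuresD[OF \<Omega> \<nu>]
  interpret \<nu>: finite_measure \<nu> by fact
  have id[measurable]: "(\<lambda>y. y) \<in> borel_measurable \<nu>"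
    using \<nu>'(1) by (rule measurable_restrict_ident)
  define K where "K = hk_kernel \<kappa> x"
  define I where "I = (\<integral>y. K y \<partial>\<nu>)"
  have I: "0 \<le> I" and Kint: "integrable \<nu> K"
    using hk_kernel_integrable[OF \<Omega> \<nu>] by (auto simp: I_def K_def)
  have K: "0 \<le> K y" "K y \<le> 1" for y by (auto simp: K_def hk_kernel_bounds)
  have [measurable]: "K \<in> borel_measurable \<nu>" using Kint by simp
  \<comment> \<open>For \<open>I = 0\<close> division by zero gives \<open>c = 0\<close>, and the
    plan becomes the zero measure, which is the right one in that case.\<close>
  define c where "c = 1 / sqrt I"
  have c: "0 \<le> c" using I by (simp add: c_def)
  have cI: "c * I = sqrt I" using I by (simp add: c_def real_div_sqrt)
  define \<eta> where "\<eta> y = ennreal (c * K y)" for y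
  have [measurable]: "\<eta> \<in> borel_measurable \<nu>" unfolding \<eta>_def by measurable
  let ?Q = "density \<nu> \<eta>"
  have Qtot: "emeasure ?Q \<Omega> = ennreal (sqrt I)"
  proof -
    have "emeasure ?Q \<Omega> = (\<integral>\<^sup>+ y. \<eta> y * indicator \<Omega> y \<partial>\<nu>)"
      using \<nu>'(2) by (subst emeasure_density) (auto simp flip: \<nu>'(2))
    also have "\<dots> = (\<integral>\<^sup>+ y. ennreal (c * K y) \<partial>\<nu>)"
      by (intro nn_integral_cong) (auto simp: \<eta>_def \<nu>'(2))
    also have "\<dots> = ennreal (c * I)"
      using c K Kint by (subst nn_integral_eq_integral) (auto simp: I_def)
    finally show ?thesis by (simp add: cI)
  qed
  have Qfin: "finite_measure ?Q"
    by (rule finite_measureI) (simp add: \<nu>'(2) Qtot)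
  have pair: "Pair x \<in> measurable ?Q (restrict_space borel (\<Omega> \<times> \<Omega>))"
    using x \<nu>'(2)
    by (intro measurable_restrict_space2)
       (auto intro!: measurable_compose[OF id] borel_measurable_continuous_onI continuous_intros)
  define \<gamma> where "\<gamma> = distr ?Q (restrict_space borel (\<Omega> \<times> \<Omega>)) (Pair x)"
  have \<gamma>R: "\<gamma> \<in> radon_measures (\<Omega> \<times> \<Omega>)"
    unfolding \<gamma>_def using \<Omega> finite_measure.finite_measure_distr[OF Qfin pair]
    by (intro radon_measuresI closed_Times compact_imp_closed) auto
  have mfst: "fst \<in> measurable (restrict_space borel (\<Omega> \<times> \<Omega>)) (restrict_space borel \<Omega>)"
    by (intro measurable_restrict_space3 borel_measurable_continuous_onI continuous_intros) auto
  have msnd: "snd \<in> measurable (restrict_space borel (\<Omega> \<times> \<Omega>)) (restrict_space borel \<Omega>)"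
    by (intro measurable_restrict_space3 borel_measurable_continuous_onI continuous_intros) auto
  have "distr \<gamma> (restrict_space borel \<Omega>) snd = distr ?Q (restrict_space borel \<Omega>) (\<lambda>y. y)"
    unfolding \<gamma>_def using pair msnd by (subst distr_distr) (auto simp: comp_def)
  also have "\<dots> = ?Q"
    by (rule distr_id2) (simp add: \<nu>'(1))
  finally have snd: "distr \<gamma> (restrict_space borel \<Omega>) snd = ?Q" .
  define P where "P = distr \<gamma> (restrict_space borel \<Omega>) fst"
  have P: "P = distr ?Q (restrict_space borel \<Omega>) (\<lambda>y. x)"
    unfolding P_def \<gamma>_def using pair mfst
    by (subst distr_distr) (auto simp: comp_def)
  have xm: "(\<lambda>y. x) \<in> measurable ?Q (restrict_space borel \<Omega>)"
    using x by (intro measurable_const) (simp add: space_restrict_space)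
  have Ptot: "measure P \<Omega> = sqrt I"
  proof -
    have "emeasure P \<Omega> = emeasure ?Q \<Omega>"
      unfolding P using xm x \<nu>'(2)
      by (subst emeasure_distr) (auto simp: sets_restrict_space intro!: arg_cong[where f="emeasure ?Q"])
    then show ?thesis using I by (simp add: measure_def Qtot)
  qed
  have acP: "absolutely_continuous (dirac \<Omega> x) P"
    unfolding absolutely_continuous_def
  proof
    fix A assume A: "A \<in> null_sets (dirac \<Omega> x)"
    then have sA: "A \<in> sets (restrict_space borel \<Omega>)" by (simp add: null_sets_def)
    then have "x \<notin> A" using A by (auto simp: null_sets_def dirac_def)
    then have "emeasure P A = 0"
      unfolding P using xm sA by (subst emeasure_distr) auto
    then show "A \<in> null_sets P" using sA by (intro null_setsI) (auto simp: P)
  qed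
  have KLP: "KL_div P (dirac \<Omega> x) = ennreal (kl_phi (sqrt I))"
    using KL_div_dirac[OF x _ acP] Ptot by (simp add: P_def)
  have acQ: "absolutely_continuous \<nu> ?Q"
    by (rule absolutely_continuousI_density) measurable
  have "AE y in \<nu>. \<eta> y = RN_deriv \<nu> ?Q y"
    by (rule \<nu>.RN_deriv_unique) auto
  then have "AE y in \<nu>. enn2real (RN_deriv \<nu> ?Q y) = c * K y"
    by eventually_elim (use c K in \<open>metis \<eta>_def enn2real_ennreal mult_nonneg_nonneg\<close>)
  then have KLQ: "KL_div ?Q \<nu> = (\<integral>\<^sup>+ y. ennreal (kl_phi (c * K y)) \<partial>\<nu>)"
    using acQ unfolding KL_div_def by (auto intro!: nn_integral_cong_AE)
  have cost: "(\<integral>\<^sup>+ z. hk_cost \<kappa> (fst z) (snd z) \<partial>\<gamma>) = (\<integral>\<^sup>+ y. \<eta> y * hk_cost \<kappa> x y \<partial>\<nu>)"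
  proof -
    have "(\<lambda>z. hk_cost \<kappa> (fst z) (snd z)) \<in> borel_measurable (restrict_space borel (\<Omega> \<times> \<Omega>))"
      by (intro measurable_restrict_space1 measurable_hk_cost borel_measurable_continuous_onI continuous_intros)
    then have "(\<integral>\<^sup>+ z. hk_cost \<kappa> (fst z) (snd z) \<partial>\<gamma>) = (\<integral>\<^sup>+ y. hk_cost \<kappa> x y \<partial>?Q)"
      unfolding \<gamma>_def using pair by (subst nn_integral_distr) auto
    then show ?thesis by (simp add: nn_integral_density)
  qed
  \<comment> \<open>The logarithm of \<open>K\<close> inside \<open>kl_phi\<close> cancels the cost,
    and what remains is affine in \<open>K\<close>, hence integrable. Where \<open>K\<close>
    vanishes, \<open>0 * \<infinity> = 0\<close> absorbs the infinite cost.\<close>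
  have point: "\<eta> y * hk_cost \<kappa> x y + ennreal (kl_phi (c * K y)) = ennreal (c * K y * ln c - c * K y + 1)" for y
  proof (cases "c * K y = 0")
    case True
    show ?thesis unfolding \<eta>_def kl_phi_def True by simp
  next
    case False
    then have pos: "0 < c" "0 < K y" using c K[of y] by (auto simp: less_le)
    have l: "ln (K y) \<le> 0" using pos K by simp
    have "\<eta> y * hk_cost \<kappa> x y = ennreal (c * K y * (- ln (K y)))"
      using pos l by (subst ennreal_mult) (auto simp: \<eta>_def hk_cost_eq[OF \<kappa>] K_def[symmetric])
    also have "\<dots> + ennreal (kl_phi (c * K y)) = ennreal (c * K y * (- ln (K y)) + kl_phi (c * K y))"
      using pos l kl_phi_nonneg[of "c * K y"]
      by (intro ennreal_plus[symmetric] mult_nonneg_nonneg) auto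
    also have "c * K y * (- ln (K y)) + kl_phi (c * K y) = c * K y * ln c - c * K y + 1"
      using pos by (simp add: kl_phi_def ln_mult algebra_simps)
    finally show ?thesis .
  qed
  have point0: "0 \<le> c * K y * ln c - c * K y + 1" for y
  proof (cases "c * K y = 0")
    case False
    then have pos: "0 < c" "0 < K y" using c K[of y] by (auto simp: less_le)
    have "ln (K y) \<le> 0" using pos K by simp
    then have "0 \<le> c * K y * (- ln (K y))" using pos by (intro mult_nonneg_nonneg) auto
    moreover have "0 \<le> kl_phi (c * K y)" using pos by (simp add: kl_phi_nonneg)
    ultimately have "0 \<le> c * K y * (- ln (K y)) + kl_phi (c * K y)" by simp
    also have "\<dots> = c * K y * ln c - c * K y + 1"
      using pos by (simp add: kl_phi_def ln_mult algebra_simps)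
    finally show ?thesis .
  next
    case True
    show ?thesis unfolding True by simp
  qed
  have int: "integrable \<nu> (\<lambda>y. c * K y * ln c - c * K y + 1)" using Kint by simp
  have total: "(\<integral>y. c * K y * ln c - c * K y + 1 \<partial>\<nu>) = sqrt I * ln c - sqrt I + measure \<nu> \<Omega>"
    using Kint by (simp add: \<nu>'(2) I_def[symmetric] cI)
  have "HK_sq \<Omega> \<kappa> (dirac \<Omega> x) \<nu> \<le> (\<integral>\<^sup>+ z. hk_cost \<kappa> (fst z) (snd z) \<partial>\<gamma>) + KL_div P (dirac \<Omega> x) + KL_div ?Q \<nu>"
    unfolding HK_sq_def P_def snd[symmetric] using \<gamma>R by (rule INF_lower)
  also have "\<dots> = (\<integral>\<^sup>+ y. \<eta> y * hk_cost \<kappa> x y + ennreal (kl_phi (c * K y)) \<partial>\<nu>) + ennreal (kl_phi (sqrt I))"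
    unfolding cost KLP KLQ by (subst nn_integral_add) (auto simp: ac_simps)
  also have "\<dots> = ennreal (sqrt I * ln c - sqrt I + measure \<nu> \<Omega>) + ennreal (kl_phi (sqrt I))"
    unfolding point using int point0 by (subst nn_integral_eq_integral) (auto simp: total)
  also have "\<dots> = ennreal (sqrt I * ln c - sqrt I + measure \<nu> \<Omega> + kl_phi (sqrt I))"
    using I kl_phi_nonneg[of "sqrt I"] integral_nonneg_AE[of "\<lambda>y. c * K y * ln c - c * K y + 1" \<nu>] point0
    by (intro ennreal_plus[symmetric]) (auto simp: total)
  \<comment> \<open>The logarithm in \<open>kl_phi (sqrt I)\<close> cancels
    \<open>sqrt I * ln c\<close>; for \<open>I = 0\<close> the value \<open>kl_phi 0 = 1\<close>
    supplies the constant.\<close>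
  also have "sqrt I * ln c - sqrt I + measure \<nu> \<Omega> + kl_phi (sqrt I) = 1 + measure \<nu> \<Omega> - 2 * sqrt I"
    using I by (auto simp: kl_phi_def c_def ln_div)
  finally show ?thesis by (simp add: I_def K_def)
qed

lemma HK_sq_dirac:
  fixes \<Omega> :: "'a::{second_countable_topology, complete_space} set"
  assumes "\<kappa> > 0" "compact \<Omega>" "x \<in> \<Omega>" "\<nu> \<in> radon_measures \<Omega>"
  shows "HK_sq \<Omega> \<kappa> (dirac \<Omega> x) \<nu> = ennreal (1 + measure \<nu> \<Omega> - 2 * sqrt (\<integral>y. hk_kernel \<kappa> x y \<partial>\<nu>))"
  by (rule antisym[OF HK_sq_dirac_upper[OF assms] HK_sq_dirac_lower[OF assms]])

section \<open>Detecting atoms\<close>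

text \<open>The profile of \<open>hk_kernel\<close> along a line, in units of
  \<open>\<kappa>\<close>.\<close>

definition cos_bump :: "real \<Rightarrow> real" where
  "cos_bump s = (if \<bar>s\<bar> < pi / 2 then (cos s)\<^sup>2 else 0)"

lemma cos_bump_bounds: "0 \<le> cos_bump s" "cos_bump s \<le> 1"
  by (auto simp: cos_bump_def power_le_one abs_square_le_1)

lemma cos_bump_pos:
  assumes "\<bar>s\<bar> < pi / 2"
  shows "0 < cos_bump s"
proof -
  have "0 < cos s" using assms by (intro cos_gt_zero_pi) (auto simp: abs_less_iff)
  then show ?thesis using assms by (simp add: cos_bump_def)
qed

lemma measurable_cos_bump [measurable]: "cos_bump \<in> borel_measurable borel"
  unfolding cos_bump_def by measurable

lemma sin_sq_diff: "(sin a)\<^sup>2 - (sin b)\<^sup>2 = sin (a + b) * sin (a - b)" for a b :: real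
proof -
  have "sin (a + b) * sin (a - b) = (sin a)\<^sup>2 * (cos b)\<^sup>2 - (cos a)\<^sup>2 * (sin b)\<^sup>2"
    by (simp add: sin_add sin_diff power2_eq_square algebra_simps)
  then show ?thesis by (simp add: cos_squared_eq algebra_simps)
qed

text \<open>The square of the sine is a combination of the exponentials with exponents
  \<open>0\<close> and \<open>2 * i * x\<close>, \<open>- 2 * i * x\<close>. The coefficients are
  those of the polynomial \<open>(z - 1) * (z\<^sup>2 - 2 * cos (2 * h) * z + 1)\<close>, whose
  roots are the factors by which these exponentials change under a shift by
  \<open>h\<close>.\<close>

lemma sin_sq_annihilator:
  fixes x h :: real
  shows "(sin x)\<^sup>2 - (1 + 2 * cos (2 * h)) * (sin (x - h))\<^sup>2
    + (1 + 2 * cos (2 * h)) * (sin (x - 2 * h))\<^sup>2 - (sin (x - 3 * h))\<^sup>2 = 0"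
proof -
  have "sin (3 * h) = (1 + 2 * cos (2 * h)) * sin h"
    using sin_add[of "2 * h" h] sin_double[of h] cos_double_cos[of h]
    by (simp add: power2_eq_square) (simp add: algebra_simps)
  moreover have "(sin x)\<^sup>2 - (sin (x - 3 * h))\<^sup>2 = sin (2 * x - 3 * h) * sin (3 * h)"
    by (simp add: sin_sq_diff)
  moreover have "(sin (x - h))\<^sup>2 - (sin (x - 2 * h))\<^sup>2 = sin (2 * x - 3 * h) * sin h"
    by (simp add: sin_sq_diff)
  ultimately show ?thesis by algebra
qed

text \<open>
  This combination of four translates annihilates the bump wherever it is smooth, so only its
  inner edge survives, as an exponential B-spline supported in \<open>{0..3 * h}\<close>.
\<close>

definition edge_spline :: "real \<Rightarrow> real \<Rightarrow> real" where
  "edge_spline h x = cos_bump (pi / 2 - x) - (1 + 2 * cos (2 * h)) * cos_bump (pi / 2 + h - x)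
     + (1 + 2 * cos (2 * h)) * cos_bump (pi / 2 + 2 * h - x) - cos_bump (pi / 2 + 3 * h - x)"

lemma measurable_edge_spline [measurable]: "edge_spline h \<in> borel_measurable borel"
  unfolding edge_spline_def by measurable

text \<open>Measured inward from its right edge, the bump starts as the square of the sine; the
  bound \<open>y < pi\<close> keeps the opposite edge out of sight.\<close>

lemma cos_bump_edge: "y < pi \<Longrightarrow> cos_bump (pi / 2 - y) = (if 0 < y then (sin y)\<^sup>2 else 0)"
  by (auto simp: cos_bump_def abs_if sin_cos_eq)

text \<open>The four terms switch on one after the other at \<open>0\<close>, \<open>h\<close>,
  \<open>2 * h\<close> and \<open>3 * h\<close>. Once three are on,
  \<open>sin_sq_annihilator\<close> replaces their sum by the missing fourth; once all are on, they
  cancel.\<close>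

lemma edge_spline_cases:
  assumes "0 < h" "x < pi"
  shows "edge_spline h x =
    (if x \<le> 0 \<or> 3 * h \<le> x then 0 else if x \<le> h then (sin x)\<^sup>2
     else if x \<le> 2 * h then (sin x)\<^sup>2 - (1 + 2 * cos (2 * h)) * (sin (x - h))\<^sup>2
     else (sin (3 * h - x))\<^sup>2)"
proof -
  have e: "pi / 2 + h - x = pi / 2 - (x - h)" "pi / 2 + 2 * h - x = pi / 2 - (x - 2 * h)"
    "pi / 2 + 3 * h - x = pi / 2 - (x - 3 * h)" by auto
  have s: "(sin (3 * h - x))\<^sup>2 = (sin (x - 3 * h))\<^sup>2"
    using sin_minus[of "x - 3 * h"] by simp
  show ?thesis
    unfolding edge_spline_def e s using assms sin_sq_annihilator[of x h]
    by (auto simp: cos_bump_edge)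
qed

lemma sin_ge_half:
  assumes "0 \<le> x" "x \<le> pi / 3"
  shows "x / 2 \<le> sin x"
proof (cases "x = 0")
  case False
  then have "0 < x" using assms by simp
  then obtain z where z: "0 < z" "z < x" "sin x - sin 0 = (x - 0) * cos z"
    using MVT2[of 0 x sin cos] by (auto intro!: derivative_eq_intros)
  have "cos (pi / 3) \<le> cos z" using z assms by (intro cos_monotone_0_pi_le) auto
  then have "x * (1 / 2) \<le> x * cos z" using \<open>0 < x\<close> by (intro mult_left_mono) (auto simp: cos_60)
  then show ?thesis using z by simp
qed simp

text \<open>The spline has size of order \<open>h\<^sup>2\<close> and support of length
  \<open>3 * h\<close>. It thus weighs an atom by order \<open>h\<^sup>2\<close>, but a measure of
  bounded density only by order \<open>h\<^sup>3\<close>.\<close>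

lemma edge_spline_bounds:
  assumes h: "0 < h" "h \<le> pi / 6" and x: "x < pi"
  shows "0 \<le> edge_spline h x" "edge_spline h x \<le> 9 * h\<^sup>2"
    "x \<le> 0 \<or> 3 * h \<le> x \<Longrightarrow> edge_spline h x = 0"
    "h / 2 \<le> x \<Longrightarrow> x \<le> h \<Longrightarrow> h\<^sup>2 / 16 \<le> edge_spline h x"
proof -
  have c: "0 \<le> 1 + 2 * cos (2 * h)" "1 + 2 * cos (2 * h) \<le> 3"
    using cos_ge_zero[of "2 * h"] h by auto
  \<comment> \<open>Put \<open>y = x - h\<close>, so \<open>y \<le> h \<le> pi / 6\<close>. Then the
    factor is at most \<open>3 \<le> 4 * (cos y)\<^sup>2\<close>, the product is at most the square
    of \<open>sin (2 * y)\<close>, and \<open>2 * y \<le> x\<close>.\<close>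
  have mid: "(1 + 2 * cos (2 * h)) * (sin (x - h))\<^sup>2 \<le> (sin x)\<^sup>2" if "h < x" "x \<le> 2 * h"
  proof -
    define y where "y = x - h"
    have y: "0 < y" "y \<le> h" using that by (auto simp: y_def)
    have "cos (pi / 6) \<le> cos y" using y h by (intro cos_monotone_0_pi_le) auto
    then have "(sqrt 3 / 2)\<^sup>2 \<le> (cos y)\<^sup>2" by (intro power_mono) (auto simp: cos_30)
    then have "3 \<le> 4 * (cos y)\<^sup>2" by (simp add: power_divide)
    have sy: "0 \<le> sin y" "0 \<le> cos y" using y h by (auto intro!: sin_ge_zero cos_ge_zero)
    have "(1 + 2 * cos (2 * h)) * (sin y)\<^sup>2 \<le> 3 * (sin y)\<^sup>2"
      using c by (intro mult_right_mono) auto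
    also have "\<dots> \<le> 4 * (cos y)\<^sup>2 * (sin y)\<^sup>2"
      using \<open>3 \<le> 4 * (cos y)\<^sup>2\<close> by (intro mult_right_mono) auto
    also have "\<dots> = (sin (2 * y))\<^sup>2" by (simp add: sin_double power_mult_distrib)
    also have "\<dots> \<le> (sin x)\<^sup>2"
    proof (rule power_mono)
      show "sin (2 * y) \<le> sin x" using y h that by (intro sin_monotone_2pi_le) (auto simp: y_def)
      show "0 \<le> sin (2 * y)" using sy by (simp add: sin_double)
    qed
    finally show ?thesis by (simp add: y_def)
  qed
  have sq: "(sin y)\<^sup>2 \<le> y\<^sup>2" for y :: real
    using abs_sin_x_le_abs_x[of y] by (simp add: abs_le_square_iff)
  show "0 \<le> edge_spline h x"
    using mid by (auto simp: edge_spline_cases[OF h(1) x])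
  have b: "(sin y)\<^sup>2 \<le> 9 * h\<^sup>2" if "0 \<le> y" "y \<le> 3 * h" for y
  proof -
    have "y\<^sup>2 \<le> (3 * h)\<^sup>2" using that by (intro power_mono) auto
    then show ?thesis using sq[of y] by (simp add: power_mult_distrib)
  qed
  have "0 \<le> (1 + 2 * cos (2 * h)) * (sin (x - h))\<^sup>2" using c by simp
  then show "edge_spline h x \<le> 9 * h\<^sup>2"
    using b[of x] b[of "3 * h - x"] by (auto simp: edge_spline_cases[OF h(1) x])
  show "x \<le> 0 \<or> 3 * h \<le> x \<Longrightarrow> edge_spline h x = 0"
    by (simp add: edge_spline_cases[OF h(1) x])
  show "h\<^sup>2 / 16 \<le> edge_spline h x" if "h / 2 \<le> x" "x \<le> h"
  proof -
    have "h / 4 \<le> sin x" using sin_ge_half[of x] that h by auto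
    then have "(h / 4)\<^sup>2 \<le> (sin x)\<^sup>2" using h by (intro power_mono) auto
    then show ?thesis using that h by (simp add: edge_spline_cases[OF h(1) x] power_divide)
  qed
qed

lemma AE_lborel_translate:
  fixes P :: "real \<Rightarrow> bool"
  assumes "AE t in lborel. P t"
  shows "AE t in lborel. P (c + t)"
proof -
  have "AE t in distr lborel borel ((+) c). P t"
    using assms by (simp only: lborel_distr_plus)
  then show ?thesis by (rule AE_distrD[rotated]) simp
qed

text \<open>A null set contains no interval of positive length. This allows evaluating almost
  everywhere identities at a point of a prescribed small window.\<close>

lemma AE_lborel_interval:
  fixes P :: "real \<Rightarrow> bool"
  assumes "AE t in lborel. P t" "a < b"
  obtains t where "a < t" "t < b" "P t"
proof -
  have "\<exists>t\<in>{a<..<b}. P t"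
  proof (rule ccontr)
    assume *: "\<not> (\<exists>t\<in>{a<..<b}. P t)"
    from assms(1) have "AE t in lborel. t \<notin> {a<..<b}"
      by eventually_elim (use * in auto)
    then have "{a<..<b} \<in> null_sets lborel"
      by (intro AE_iff_null_sets[THEN iffD2]) auto
    then show False using \<open>a < b\<close> by (simp add: null_sets_def)
  qed
  then show ?thesis using that by auto
qed

lemma cos_bump_integrable:
  assumes "finite_measure M" "sets M = sets borel"
  shows "integrable M (\<lambda>s. cos_bump (t - s))"
proof -
  interpret finite_measure M by fact
  have [measurable_cong]: "sets M = sets borel" by fact
  show ?thesis
    by (rule integrable_const_bound[where B=1]) (auto simp: cos_bump_bounds)
qed

text \<open>Translates of \<open>edge_spline\<close> are combinations of translates of the bump, so
  \<open>M\<close> and \<open>N\<close> give them equal integrals. With the spline placed just below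
  \<open>a\<close>, the integral is at least \<open>h\<^sup>2 / 16\<close> times the atom of
  \<open>M\<close> and at most \<open>27 * L * h\<^sup>3\<close> by the density bound for
  \<open>N\<close>. Division by \<open>h\<^sup>2\<close> and \<open>h\<close> tending to 0 finish
  the argument.\<close>

lemma no_atom_if_same_potential:
  assumes M: "finite_measure M" "sets M = sets borel" "AE s in M. \<bar>s\<bar> \<le> 1"
    and N: "finite_measure N" "sets N = sets borel" "AE s in N. \<bar>s\<bar> \<le> 1"
    and L: "\<And>a b. a \<le> b \<Longrightarrow> measure N {a..b} \<le> L * (b - a)"
    and eq: "AE t in lborel. (\<integral>s. cos_bump (t - s) \<partial>M) = (\<integral>s. cos_bump (t - s) \<partial>N)"
  shows "measure M {a} = 0"
proof (cases "\<bar>a\<bar> \<le> 1")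
  case False
  have "{a} \<in> null_sets M"
    using M(3) False by (intro AE_iff_null_sets[THEN iffD2]) (auto simp: M(2) elim!: eventually_mono)
  then show ?thesis by (simp add: null_sets_def measure_def)
next
  case True
  interpret M: finite_measure M by fact
  interpret N: finite_measure N by fact
  have [measurable_cong]: "sets M = sets borel" "sets N = sets borel" by fact+
  define F where "F K t = (\<integral>s. cos_bump (t - s) \<partial>K)" for t and K :: "real measure"
  have spline: "integrable K (\<lambda>s. edge_spline h (s - \<tau>)) \<and>
    (\<integral>s. edge_spline h (s - \<tau>) \<partial>K) = F K (pi / 2 + \<tau>) - (1 + 2 * cos (2 * h)) * F K (pi / 2 + h + \<tau>)
      + (1 + 2 * cos (2 * h)) * F K (pi / 2 + 2 * h + \<tau>) - F K (pi / 2 + 3 * h + \<tau>)"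
    if "finite_measure K" "sets K = sets borel" for K h \<tau>
  proof -
    have "edge_spline h (s - \<tau>) = cos_bump (pi / 2 + \<tau> - s) - (1 + 2 * cos (2 * h)) * cos_bump (pi / 2 + h + \<tau> - s)
     + (1 + 2 * cos (2 * h)) * cos_bump (pi / 2 + 2 * h + \<tau> - s) - cos_bump (pi / 2 + 3 * h + \<tau> - s)" for s
      by (simp add: edge_spline_def algebra_simps)
    then show ?thesis
      using cos_bump_integrable[OF that] by (simp add: F_def)
  qed
  have bound: "measure M {a} \<le> 432 * L * h" if h: "0 < h" "h \<le> 1 / 10" for h
  proof -
    have hpi: "h \<le> pi / 6" using h pi_gt3 by simp
    have "AE \<tau> in lborel. F M (pi / 2 + \<tau>) = F N (pi / 2 + \<tau>) \<and> F M (pi / 2 + h + \<tau>) = F N (pi / 2 + h + \<tau>)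
      \<and> F M (pi / 2 + 2 * h + \<tau>) = F N (pi / 2 + 2 * h + \<tau>) \<and> F M (pi / 2 + 3 * h + \<tau>) = F N (pi / 2 + 3 * h + \<tau>)"
      using eq unfolding F_def by (intro AE_conjI AE_lborel_translate)
    \<comment> \<open>The window places \<open>a - \<tau>\<close> between \<open>h / 2\<close> and
      \<open>h\<close>, where the spline is at least \<open>h\<^sup>2 / 16\<close>.\<close>
    then obtain \<tau> where \<tau>: "a - h < \<tau>" "\<tau> < a - h / 2"
      and "F M (pi / 2 + \<tau>) = F N (pi / 2 + \<tau>)" "F M (pi / 2 + h + \<tau>) = F N (pi / 2 + h + \<tau>)"
        "F M (pi / 2 + 2 * h + \<tau>) = F N (pi / 2 + 2 * h + \<tau>)" "F M (pi / 2 + 3 * h + \<tau>) = F N (pi / 2 + 3 * h + \<tau>)"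
      by (rule AE_lborel_interval[where a="a - h" and b="a - h / 2"]) (use h in auto)
    then have same: "(\<integral>s. edge_spline h (s - \<tau>) \<partial>M) = (\<integral>s. edge_spline h (s - \<tau>) \<partial>N)"
      using spline[OF M(1,2)] spline[OF N(1,2)] by simp
    \<comment> \<open>Here \<open>s - \<tau> < 2 + h\<close>, which is below \<open>pi\<close>: both
      measures are so concentrated that the other edge of the bump stays out of reach.\<close>
    have lt: "s - \<tau> < pi" if "\<bar>s\<bar> \<le> 1" for s
      using that \<tau> True h pi_gt3 by auto
    have "h\<^sup>2 / 16 * measure M {a} = (\<integral>s. h\<^sup>2 / 16 * indicator {a} s \<partial>M)"
      by simp
    also have "\<dots> \<le> (\<integral>s. edge_spline h (s - \<tau>) \<partial>M)"
    proof (rule integral_mono_AE)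
      show "AE s in M. h\<^sup>2 / 16 * indicator {a} s \<le> edge_spline h (s - \<tau>)"
        using M(3)
      proof eventually_elim
        case (elim s)
        show ?case
          using edge_spline_bounds(1,4)[OF h(1) hpi lt[OF elim]] \<tau> by (auto simp: indicator_def)
      qed
      show "integrable M (\<lambda>s. h\<^sup>2 / 16 * indicator {a} s)"
        by (intro integrable_mult_right integrable_real_indicator) (auto simp: M.emeasure_eq_measure)
    qed (use spline[OF M(1,2)] in auto)
    also have "\<dots> = (\<integral>s. edge_spline h (s - \<tau>) \<partial>N)" by (rule same)
    also have "\<dots> \<le> (\<integral>s. 9 * h\<^sup>2 * indicator {\<tau>..\<tau> + 3 * h} s \<partial>N)"
    proof (rule integral_mono_AE)
      show "AE s in N. edge_spline h (s - \<tau>) \<le> 9 * h\<^sup>2 * indicator {\<tau>..\<tau> + 3 * h} s"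
        using N(3)
      proof eventually_elim
        case (elim s)
        show ?case
          using edge_spline_bounds(2,3)[OF h(1) hpi lt[OF elim]] by (auto simp: indicator_def)
      qed
      show "integrable N (\<lambda>s. 9 * h\<^sup>2 * indicator {\<tau>..\<tau> + 3 * h} s)"
        by (intro integrable_mult_right integrable_real_indicator) (auto simp: N.emeasure_eq_measure)
    qed (use spline[OF N(1,2)] in auto)
    also have "\<dots> = 9 * h\<^sup>2 * measure N {\<tau>..\<tau> + 3 * h}" by simp
    also have "\<dots> \<le> 9 * h\<^sup>2 * (L * (3 * h))"
      using L[of \<tau> "\<tau> + 3 * h"] h by (intro mult_left_mono) auto
    finally have "h\<^sup>2 / 16 * measure M {a} \<le> h\<^sup>2 / 16 * (432 * L * h)"
      by (simp add: mult_ac)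
    then show ?thesis using h by (subst (asm) mult_le_cancel_left_pos) auto
  qed
  have "((\<lambda>h. 432 * L * h) \<longlongrightarrow> 432 * L * 0) (at_right 0)"
    by (intro tendsto_intros)
  moreover have "eventually (\<lambda>h. measure M {a} \<le> 432 * L * h) (at_right 0)"
    unfolding eventually_at_right_field by (intro exI[of _ "1 / 10"]) (use bound in auto)
  ultimately have "measure M {a} \<le> 432 * L * 0"
    by (rule tendsto_lowerbound) simp
  then show ?thesis using measure_nonneg[of M "{a}"] by simp
qed

section \<open>Potentials on the line\<close>

text \<open>The parameter counts lengths of \<open>\<kappa>\<close>, so that the kernel on the
  diameter is \<open>cos_bump\<close> without any scaling.\<close>

definition line_embed :: "real \<Rightarrow> 'a::euclidean_space \<Rightarrow> real \<Rightarrow> 'a" where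
  "line_embed \<kappa> b t = (t * \<kappa>) *\<^sub>R b"

lemma measurable_line_embed [measurable]: "line_embed \<kappa> b \<in> borel_measurable borel"
  unfolding line_embed_def by measurable

lemma norm_line_embed: "b \<in> Basis \<Longrightarrow> \<kappa> > 0 \<Longrightarrow> norm (line_embed \<kappa> b t) = \<kappa> * \<bar>t\<bar>"
  by (simp add: line_embed_def abs_mult)

lemma hk_kernel_line_embed:
  assumes "b \<in> Basis" "\<kappa> > 0"
  shows "hk_kernel \<kappa> (line_embed \<kappa> b t) (line_embed \<kappa> b s) = cos_bump (t - s)"
proof -
  have "dist (line_embed \<kappa> b t) (line_embed \<kappa> b s) = \<kappa> * \<bar>t - s\<bar>"
    using norm_line_embed[OF assms, of "t - s"]
    by (simp add: dist_norm line_embed_def algebra_simps)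
  then show ?thesis using assms by (simp add: hk_kernel_def cos_bump_def field_simps)
qed

text \<open>Orthogonal projection to the line does not increase the distance to a point of the line,
  and the kernel decreases with the distance.\<close>

lemma hk_kernel_le_cos_bump:
  assumes b: "b \<in> Basis" and "\<kappa> > 0"
  shows "hk_kernel \<kappa> (line_embed \<kappa> b t) y \<le> cos_bump (t - (y \<bullet> b) / \<kappa>)"
proof (cases "dist (line_embed \<kappa> b t) y < \<kappa> * pi / 2")
  case False
  then show ?thesis by (simp add: hk_kernel_def cos_bump_bounds)
next
  case True
  define r where "r = dist (line_embed \<kappa> b t) y / \<kappa>"
  have r: "0 \<le> r" "r < pi / 2"
    using True \<open>\<kappa> > 0\<close> by (auto simp: r_def field_simps)
  have "\<bar>(line_embed \<kappa> b t - y) \<bullet> b\<bar> \<le> dist (line_embed \<kappa> b t) y"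
    unfolding dist_norm using b by (rule Basis_le_norm)
  moreover have "(line_embed \<kappa> b t - y) \<bullet> b = \<kappa> * (t - (y \<bullet> b) / \<kappa>)"
    using b \<open>\<kappa> > 0\<close> by (simp add: line_embed_def inner_diff_left algebra_simps)
  ultimately have le: "\<bar>t - (y \<bullet> b) / \<kappa>\<bar> \<le> r"
    using \<open>\<kappa> > 0\<close> by (simp add: r_def abs_mult pos_le_divide_eq mult.commute)
  have "cos r \<le> cos \<bar>t - (y \<bullet> b) / \<kappa>\<bar>"
    using le r by (intro cos_monotone_0_pi_le) auto
  then have "(cos r)\<^sup>2 \<le> (cos (t - (y \<bullet> b) / \<kappa>))\<^sup>2"
    using r by (intro power_mono cos_ge_zero) auto
  moreover have "\<bar>t - (y \<bullet> b) / \<kappa>\<bar> < pi / 2" using le r by linarith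
  ultimately show ?thesis using True by (simp add: hk_kernel_def cos_bump_def r_def)
qed

definition potential :: "real measure \<Rightarrow> real \<Rightarrow> real" where
  "potential M t = (\<integral>s. cos_bump (t - s) \<partial>M)"

lemma potential_nonneg: "0 \<le> potential M t"
  by (simp add: potential_def cos_bump_bounds)

text \<open>By Tonelli and translation invariance, every unit of mass contributes the integral of
  \<open>cos_bump\<close> to that of the potential, wherever it sits.\<close>

lemma potential_facts:
  assumes M: "finite_measure M" "sets M = sets borel"
  shows "potential M \<in> borel_measurable borel"
    and "integrable lborel (potential M)"
    and "(\<integral>t. potential M t \<partial>lborel) = (\<integral>t. cos_bump t \<partial>lborel) * measure M UNIV"
    and "integrable lborel cos_bump"
proof -
  interpret M: finite_measure M by fact
  interpret P: pair_sigma_finite M lborel by standard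
  have [measurable_cong]: "sets M = sets borel" by fact
  have space: "space M = UNIV" using sets_eq_imp_space_eq[OF M(2)] by simp
  show m[measurable]: "potential M \<in> borel_measurable borel"
    unfolding potential_def by measurable
  show C: "integrable lborel cos_bump"
    by (rule integrableI_bounded_set[where A="{- (pi / 2)..pi / 2}" and B=1])
       (auto simp: cos_bump_bounds intro!: AE_I2, auto simp: cos_bump_def)
  have C0: "0 \<le> (\<integral>t. cos_bump t \<partial>lborel)"
    by (simp add: cos_bump_bounds)
  have "(\<integral>\<^sup>+ t. ennreal (potential M t) \<partial>lborel) = (\<integral>\<^sup>+ t. \<integral>\<^sup>+ s. ennreal (cos_bump (t - s)) \<partial>M \<partial>lborel)"
    unfolding potential_def using cos_bump_integrable[OF M]
    by (intro nn_integral_cong nn_integral_eq_integral[symmetric]) (auto simp: cos_bump_bounds)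
  also have "\<dots> = (\<integral>\<^sup>+ s. \<integral>\<^sup>+ t. ennreal (cos_bump (t - s)) \<partial>lborel \<partial>M)"
    by (rule P.Fubini') measurable
  also have "\<dots> = (\<integral>\<^sup>+ s. ennreal (\<integral>t. cos_bump t \<partial>lborel) \<partial>M)"
  proof (rule nn_integral_cong)
    fix s
    have "(\<integral>\<^sup>+ t. ennreal (cos_bump (t - s)) \<partial>lborel) = (\<integral>\<^sup>+ t. ennreal (cos_bump t) \<partial>lborel)"
      by (subst nn_integral_real_affine[where c=1 and t=s]) auto
    also have "\<dots> = ennreal (\<integral>t. cos_bump t \<partial>lborel)"
      using C by (intro nn_integral_eq_integral) (auto simp: cos_bump_bounds)
    finally show "(\<integral>\<^sup>+ t. ennreal (cos_bump (t - s)) \<partial>lborel) = ennreal (\<integral>t. cos_bump t \<partial>lborel)" .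
  qed
  also have "\<dots> = ennreal ((\<integral>t. cos_bump t \<partial>lborel) * measure M UNIV)"
    using C0 by (simp add: M.emeasure_eq_measure space ennreal_mult)
  finally have "integrable lborel (potential M) \<and>
    (\<integral>t. potential M t \<partial>lborel) = (\<integral>t. cos_bump t \<partial>lborel) * measure M UNIV"
    using C0 by (subst (asm) nn_integral_eq_integrable) (auto simp: potential_nonneg)
  then show "integrable lborel (potential M)"
    "(\<integral>t. potential M t \<partial>lborel) = (\<integral>t. cos_bump t \<partial>lborel) * measure M UNIV" by auto
qed


text \<open>The optimal measure in the coordinate of the line, up to the choice of \<open>m\<close>.
  The segment has length 2, which is less than \<open>pi\<close>; this lets the atom argument see a
  single edge of the bump.\<close>

definition unif_seg :: "real \<Rightarrow> real measure" where
  "unif_seg m = density lborel (\<lambda>s. ennreal (m * indicator {-1..1} s))"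

lemma sets_unif_seg: "sets (unif_seg m) = sets borel"
  by (simp add: unif_seg_def)

lemma unif_seg_measure:
  assumes "0 \<le> m" "A \<in> sets borel"
  shows "emeasure (unif_seg m) A = ennreal m * emeasure lborel ({-1..1} \<inter> A)"
proof -
  have "emeasure (unif_seg m) A = (\<integral>\<^sup>+ s. ennreal (m * indicator {-1..1} s) * indicator A s \<partial>lborel)"
    unfolding unif_seg_def using assms by (intro emeasure_density) auto
  also have "\<dots> = (\<integral>\<^sup>+ s. ennreal m * indicator ({-1..1} \<inter> A) s \<partial>lborel)"
    by (intro nn_integral_cong) (auto simp: indicator_def)
  also have "\<dots> = ennreal m * emeasure lborel ({-1..1} \<inter> A)"
    using assms by (subst nn_integral_cmult_indicator) auto
  finally show ?thesis .
qed

lemma unif_seg_UNIV: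
  assumes "0 \<le> m"
  shows "emeasure (unif_seg m) UNIV = ennreal (2 * m)"
  using unif_seg_measure[OF assms, of UNIV] assms by (simp add: ennreal_mult mult.commute)

lemma finite_unif_seg: "0 \<le> m \<Longrightarrow> finite_measure (unif_seg m)"
  using sets_eq_imp_space_eq[OF sets_unif_seg, of m] by (intro finite_measureI) (simp add: unif_seg_UNIV)

lemma AE_unif_seg: "AE s in unif_seg m. \<bar>s\<bar> \<le> 1"
  unfolding unif_seg_def by (subst AE_density) (auto simp: indicator_def)

lemma unif_seg_interval:
  assumes "0 \<le> m" "a \<le> b"
  shows "measure (unif_seg m) {a..b} \<le> m * (b - a)"
proof -
  have "emeasure (unif_seg m) {a..b} \<le> ennreal m * emeasure lborel {a..b}"
    unfolding unif_seg_measure[OF assms(1), of "{a..b}", simplified] by (intro mult_left_mono emeasure_mono) auto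
  also have "\<dots> = ennreal (m * (b - a))"
    using assms by (simp add: ennreal_mult)
  finally show ?thesis
    using assms unfolding measure_def by (intro enn2real_leI) auto
qed

lemma potential_unif_seg:
  assumes "0 \<le> m"
  shows "potential (unif_seg m) t = m * potential (unif_seg 1) t"
proof -
  have "potential (unif_seg a) t = a * (\<integral>s. indicator {-1..1} s * cos_bump (t - s) \<partial>lborel)" if "0 \<le> a" for a
    unfolding potential_def unif_seg_def using that
    by (subst integral_density) (auto simp: mult.assoc)
  from this[OF assms] this[of 1] show ?thesis by simp
qed

lemma potential_eq_0:
  assumes "AE s in M. \<bar>s\<bar> \<le> 1" "1 + pi / 2 \<le> \<bar>t\<bar>"
  shows "potential M t = 0"
proof -
  have "AE s in M. cos_bump (t - s) = 0"
    using assms(1)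
  proof eventually_elim
    case (elim s)
    have "\<not> \<bar>t - s\<bar> < pi / 2" using elim assms(2) by linarith
    then show ?case by (simp add: cos_bump_def)
  qed
  then show ?thesis unfolding potential_def by (rule integral_eq_zero_AE)
qed

lemma integral_cos_bump_pos: "0 < (\<integral>t. cos_bump t \<partial>lborel)"
proof -
  have int: "integrable lborel cos_bump"
    using potential_facts(4)[OF finite_unif_seg[of 1] sets_unif_seg] by simp
  have "(\<integral>t. cos_bump t \<partial>lborel) \<noteq> 0"
  proof
    assume "(\<integral>t. cos_bump t \<partial>lborel) = 0"
    then have "AE t in lborel. cos_bump t = 0"
      using int by (subst (asm) integral_nonneg_eq_0_iff_AE) (auto simp: cos_bump_bounds)
    then obtain t where "0 < t" "t < 1" "cos_bump t = 0"
      by (rule AE_lborel_interval[where a=0 and b=1]) auto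
    then show False using cos_bump_pos[of t] pi_gt3 by auto
  qed
  then show ?thesis using integral_nonneg_AE[of cos_bump lborel] by (auto simp: cos_bump_bounds less_le)
qed

text \<open>The integral of the root scales like \<open>sqrt m\<close>, while the target does not
  depend on \<open>m\<close>; so \<open>m\<close> is the square of the ratio of the target to the
  integral for \<open>m = 1\<close>. The normalization makes the root of the potential, divided by
  the target, a probability density.\<close>

lemma unif_seg_normalization:
  obtains m where "0 < m" "integrable lborel (\<lambda>t. sqrt (potential (unif_seg m) t))"
    "(\<integral>t. sqrt (potential (unif_seg m) t) \<partial>lborel) = (\<integral>t. cos_bump t \<partial>lborel)"
proof -
  define C where "C = (\<integral>t. cos_bump t \<partial>lborel)"
  have "0 < C" using integral_cos_bump_pos by (simp add: C_def)
  note P = potential_facts[OF finite_unif_seg[of 1] sets_unif_seg, simplified]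
  define q where "q = potential (unif_seg 1)"
  have q0: "0 \<le> q t" for t by (simp add: q_def potential_nonneg)
  have [measurable]: "q \<in> borel_measurable borel" using P(1) by (simp add: q_def)
  have q_int: "integrable lborel q" "(\<integral>t. q t \<partial>lborel) = C * 2"
    using P(2,3) unif_seg_UNIV[of 1] by (auto simp: q_def C_def measure_def)
  have int: "integrable lborel (\<lambda>t. sqrt (q t))"
  proof (rule Bochner_Integration.integrable_bound)
    \<comment> \<open>The bound is \<open>sqrt q \<le> q + 1\<close>; the potential vanishes beyond
      distance \<open>1 + pi / 2\<close>, so the constant can be cut off to an integrable
      indicator.\<close>
    show "integrable lborel (\<lambda>t. q t + indicator {- (1 + pi / 2)..1 + pi / 2} t)"
      using q_int by (intro Bochner_Integration.integrable_add integrable_real_indicator) auto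
    show "AE t in lborel. norm (sqrt (q t)) \<le> norm (q t + indicator {- (1 + pi / 2)..1 + pi / 2} t)"
    proof (rule AE_I2)
      fix t
      have "sqrt (q t) \<le> q t + indicator {- (1 + pi / 2)..1 + pi / 2} t"
      proof (cases "\<bar>t\<bar> \<le> 1 + pi / 2")
        case True
        have "sqrt (q t) \<le> q t + 1"
          using q0[of t] by (intro real_le_lsqrt) (auto simp: power2_eq_square algebra_simps)
        then show ?thesis using True by (auto simp: indicator_def abs_le_iff)
      next
        case False
        then show ?thesis using potential_eq_0[OF AE_unif_seg, of t 1] by (simp add: q_def)
      qed
      then show "norm (sqrt (q t)) \<le> norm (q t + indicator {- (1 + pi / 2)..1 + pi / 2} t)"
        using q0[of t] by simp
    qed
  qed measurable
  define W where "W = (\<integral>t. sqrt (q t) \<partial>lborel)"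
  have "W \<noteq> 0"
  proof
    assume "W = 0"
    then have "AE t in lborel. q t = 0"
      unfolding W_def using int q0 by (subst (asm) integral_nonneg_eq_0_iff_AE) auto
    then have "(\<integral>t. q t \<partial>lborel) = 0" by (rule integral_eq_zero_AE)
    then show False using q_int \<open>0 < C\<close> by simp
  qed
  moreover have "0 \<le> W" unfolding W_def using q0 by simp
  ultimately have "0 < W" by simp
  define m where "m = (C / W)\<^sup>2"
  have "0 < m" using \<open>0 < C\<close> \<open>0 < W\<close> by (simp add: m_def)
  have "sqrt (potential (unif_seg m) t) = C / W * sqrt (q t)" for t
    using potential_unif_seg[of m t] \<open>0 < m\<close> \<open>0 < C\<close> \<open>0 < W\<close>
    by (simp add: q_def real_sqrt_mult) (simp add: m_def)
  then have "integrable lborel (\<lambda>t. sqrt (potential (unif_seg m) t))"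
    "(\<integral>t. sqrt (potential (unif_seg m) t) \<partial>lborel) = C"
    using int \<open>0 < W\<close> by (auto simp: W_def[symmetric])
  then show ?thesis using that[of m] \<open>0 < m\<close> by (simp add: C_def)
qed

text \<open>A zero of the potential at \<open>t\<close> excludes mass at distance less than
  \<open>pi / 2\<close> from \<open>t\<close>. Zeros just outside \<open>1 + pi / 2\<close> and
  \<open>- (1 + pi / 2)\<close> therefore exclude everything between radius 1 and radius
  \<open>1 + pi / 2\<close>. Since zeros are given almost everywhere only, two sequences of them
  approach the two end points.\<close>

lemma AE_support_of_potential:
  assumes M: "finite_measure M" "sets M = sets borel" "AE s in M. \<bar>s\<bar> \<le> 1 + pi / 2"
    and zero: "AE t in lborel. 1 + pi / 2 \<le> \<bar>t\<bar> \<longrightarrow> potential M t = 0"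
  shows "AE s in M. \<bar>s\<bar> \<le> 1"
proof -
  define R where "R = 1 + pi / 2"
  have *: "AE s in M. cos_bump (t - s) = 0" if "potential M t = 0" for t
    using that cos_bump_integrable[OF M(1,2), of t] unfolding potential_def
    by (subst (asm) integral_nonneg_eq_0_iff_AE) (auto simp: cos_bump_bounds)
  have "\<exists>t. R < t \<and> t < R + 1 / Suc n \<and> potential M t = 0" for n :: nat
    by (rule AE_lborel_interval[OF zero, of R "R + 1 / Suc n"]) (auto simp: R_def)
  then obtain f where f: "\<And>n. R < f n \<and> f n < R + 1 / Suc n \<and> potential M (f n) = 0" by metis
  have "\<exists>t. - R - 1 / Suc n < t \<and> t < - R \<and> potential M t = 0" for n :: nat
    by (rule AE_lborel_interval[OF zero, of "- R - 1 / Suc n" "- R"]) (auto simp: R_def)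
  then obtain g where g: "\<And>n. - R - 1 / Suc n < g n \<and> g n < - R \<and> potential M (g n) = 0" by metis
  have "AE s in M. \<forall>n. cos_bump (f n - s) = 0 \<and> cos_bump (g n - s) = 0"
    using f g by (auto simp: AE_all_countable intro!: *)
  with M(3) show ?thesis
  proof eventually_elim
    case (elim s)
    show ?case
    proof (rule ccontr)
      assume "\<not> \<bar>s\<bar> \<le> 1"
      then obtain n where n: "1 / Suc n < \<bar>s\<bar> - 1"
        using nat_approx_posE[of "\<bar>s\<bar> - 1"] by auto
      have "\<bar>f n - s\<bar> < pi / 2 \<or> \<bar>g n - s\<bar> < pi / 2"
        using n f[of n] g[of n] elim(1) pi_gt3 unfolding R_def by linarith
      then show False using elim(2) cos_bump_pos by (metis less_irrefl)
    qed
  qed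
qed

section \<open>The counterexample\<close>

text \<open>The push-forward lives on \<open>borel\<close>, whereas
  \<open>radon_measures \<Omega>\<close> asks for the sigma-algebra of the subspace; hence the
  restriction. It loses no mass when \<open>M\<close> lives on parameters that are mapped into
  \<open>\<Omega>\<close>.\<close>

definition line_measure :: "'a::euclidean_space set \<Rightarrow> real \<Rightarrow> 'a \<Rightarrow> real measure \<Rightarrow> 'a measure" where
  "line_measure \<Omega> \<kappa> b M = restrict_space (distr M borel (line_embed \<kappa> b)) \<Omega>"

lemma line_measure:
  fixes b :: "'a::euclidean_space" and r \<kappa> :: real
  defines "\<Omega> \<equiv> cball 0 (\<kappa> * r)"
  assumes b: "b \<in> Basis" and \<kappa>: "\<kappa> > 0"
    and M: "finite_measure M" "sets M = sets borel" "AE t in M. \<bar>t\<bar> \<le> r"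
  shows "line_measure \<Omega> \<kappa> b M \<in> radon_measures \<Omega>"
    and "emeasure (line_measure \<Omega> \<kappa> b M) \<Omega> = emeasure M UNIV"
    and "f \<in> borel_measurable borel \<Longrightarrow>
      (\<integral>\<^sup>+ x. f x \<partial>line_measure \<Omega> \<kappa> b M) = (\<integral>\<^sup>+ t. f (line_embed \<kappa> b t) \<partial>M)"
    and "g \<in> borel_measurable borel \<Longrightarrow>
      (\<integral>x. g x \<partial>line_measure \<Omega> \<kappa> b M) = (\<integral>t. g (line_embed \<kappa> b t) \<partial>M :: real)"
proof -
  interpret M: finite_measure M by fact
  have [measurable_cong]: "sets M = sets borel" by fact
  have space: "space M = UNIV" using sets_eq_imp_space_eq[OF M(2)] by simp
  have \<Omega>[measurable]: "\<Omega> \<in> sets borel" by (simp add: \<Omega>_def)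
  let ?D = "distr M borel (line_embed \<kappa> b)"
  have AE: "AE t in M. line_embed \<kappa> b t \<in> \<Omega>"
    using M(3) by eventually_elim (use norm_line_embed[OF b \<kappa>] \<kappa> in \<open>simp add: \<Omega>_def\<close>)
  show nn: "(\<integral>\<^sup>+ x. f x \<partial>line_measure \<Omega> \<kappa> b M) = (\<integral>\<^sup>+ t. f (line_embed \<kappa> b t) \<partial>M)"
    if [measurable]: "f \<in> borel_measurable borel" for f
  proof -
    have "(\<integral>\<^sup>+ x. f x \<partial>line_measure \<Omega> \<kappa> b M) = (\<integral>\<^sup>+ x. f x * indicator \<Omega> x \<partial>?D)"
      unfolding line_measure_def by (subst nn_integral_restrict_space) auto
    also have "\<dots> = (\<integral>\<^sup>+ t. f (line_embed \<kappa> b t) * indicator \<Omega> (line_embed \<kappa> b t) \<partial>M)"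
      by (subst nn_integral_distr) auto
    also have "\<dots> = (\<integral>\<^sup>+ t. f (line_embed \<kappa> b t) \<partial>M)"
      using AE by (intro nn_integral_cong_AE) (auto elim!: eventually_mono)
    finally show ?thesis .
  qed
  show "(\<integral>x. g x \<partial>line_measure \<Omega> \<kappa> b M) = (\<integral>t. g (line_embed \<kappa> b t) \<partial>M)"
    if [measurable]: "g \<in> borel_measurable borel" for g :: "'a \<Rightarrow> real"
  proof -
    have "(\<integral>x. g x \<partial>line_measure \<Omega> \<kappa> b M) = (\<integral>x. indicator \<Omega> x *\<^sub>R g x \<partial>?D)"
      unfolding line_measure_def by (subst integral_restrict_space) auto
    also have "\<dots> = (\<integral>t. indicator \<Omega> (line_embed \<kappa> b t) *\<^sub>R g (line_embed \<kappa> b t) \<partial>M)"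
      by (subst integral_distr) auto
    also have "\<dots> = (\<integral>t. g (line_embed \<kappa> b t) \<partial>M)"
      using AE by (intro integral_cong_AE) (auto elim!: eventually_mono)
    finally show ?thesis .
  qed
  have sp: "space (line_measure \<Omega> \<kappa> b M) = \<Omega>"
    by (simp add: line_measure_def space_restrict_space)
  show em: "emeasure (line_measure \<Omega> \<kappa> b M) \<Omega> = emeasure M UNIV"
    using nn[of "\<lambda>_. 1"] by (simp add: sp space)
  show "line_measure \<Omega> \<kappa> b M \<in> radon_measures \<Omega>"
  proof (rule radon_measuresI)
    show "sets (line_measure \<Omega> \<kappa> b M) = sets (restrict_space borel \<Omega>)"
      unfolding line_measure_def by (intro sets_restrict_space_cong) simp
    show "finite_measure (line_measure \<Omega> \<kappa> b M)"
      by (rule finite_measureI) (use M.emeasure_finite[of UNIV] in \<open>simp add: sp em\<close>)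
  qed (simp add: \<Omega>_def)
qed

lemma measurable_hk_integral:
  fixes \<Omega> :: "'a::{second_countable_topology, complete_space} set"
  assumes "compact \<Omega>" "\<nu> \<in> radon_measures \<Omega>"
  shows "(\<lambda>x. \<integral>y. hk_kernel \<kappa> x y \<partial>\<nu>) \<in> borel_measurable borel"
proof -
  note \<nu>' = radon_measuresD[OF assms]
  interpret \<nu>: finite_measure \<nu> by fact
  have "(\<lambda>z. snd z) \<in> borel_measurable (borel \<Otimes>\<^sub>M \<nu>)"
    using measurable_restrict_ident[OF \<nu>'(1)] by (rule measurable_compose[OF measurable_snd])
  then have "(\<lambda>z. hk_kernel \<kappa> (fst z) (snd z)) \<in> borel_measurable (borel \<Otimes>\<^sub>M \<nu>)"
    by measurable
  then show ?thesis
    by (intro \<nu>.borel_measurable_lebesgue_integral) (simp add: case_prod_beta')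
qed

lemma hk_objective_line_measure:
  fixes b :: "'a::euclidean_space" and r \<kappa> :: real
  defines "\<Omega> \<equiv> cball 0 (\<kappa> * r)"
  assumes b: "b \<in> Basis" and \<kappa>: "\<kappa> > 0"
    and M: "finite_measure M" "sets M = sets borel" "AE t in M. \<bar>t\<bar> \<le> r"
    and \<nu>: "\<nu> \<in> radon_measures \<Omega>"
  shows "hk_objective \<Omega> \<kappa> (line_measure \<Omega> \<kappa> b M) \<nu> =
    (\<integral>\<^sup>+ t. ennreal (1 + measure \<nu> \<Omega> - 2 * sqrt (\<integral>y. hk_kernel \<kappa> (line_embed \<kappa> b t) y \<partial>\<nu>)) \<partial>M)"
proof -
  have \<Omega>: "compact \<Omega>" by (simp add: \<Omega>_def)
  note [measurable] = measurable_hk_integral[OF \<Omega> \<nu>]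
  have "space (line_measure \<Omega> \<kappa> b M) = \<Omega>"
    by (simp add: line_measure_def space_restrict_space)
  then have "hk_objective \<Omega> \<kappa> (line_measure \<Omega> \<kappa> b M) \<nu> =
    (\<integral>\<^sup>+ x. ennreal (1 + measure \<nu> \<Omega> - 2 * sqrt (\<integral>y. hk_kernel \<kappa> x y \<partial>\<nu>)) \<partial>line_measure \<Omega> \<kappa> b M)"
    unfolding hk_objective_def by (intro nn_integral_cong HK_sq_dirac[OF \<kappa> \<Omega> _ \<nu>]) simp
  also have "\<dots> = (\<integral>\<^sup>+ t. ennreal (1 + measure \<nu> \<Omega> - 2 * sqrt (\<integral>y. hk_kernel \<kappa> (line_embed \<kappa> b t) y \<partial>\<nu>)) \<partial>M)"
    unfolding \<Omega>_def by (rule line_measure(3)[OF b \<kappa> M]) (simp add: \<Omega>_def[symmetric])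
  finally show ?thesis .
qed

text \<open>Each weight is bounded by the mass of its own point, so all weights vanish.\<close>

lemma discrete_measure_eq_0:
  fixes \<Omega> :: "'a::t1_space set"
  assumes "discrete_measure \<Omega> \<nu>" and sets: "sets \<nu> = sets (restrict_space borel \<Omega>)"
    and "\<Omega> \<in> sets borel" and atoms: "\<And>a. a \<in> \<Omega> \<Longrightarrow> emeasure \<nu> {a} = 0"
  shows "emeasure \<nu> \<Omega> = 0"
proof -
  obtain S w where S: "S \<subseteq> \<Omega>"
    and w: "\<And>A. A \<in> sets \<nu> \<Longrightarrow> emeasure \<nu> A = (\<integral>\<^sup>+ a. w a * emeasure (dirac \<Omega> a) A \<partial>count_space S)"
    using assms(1) unfolding discrete_measure_def by blast
  have meas: "{a} \<in> sets (restrict_space borel \<Omega>)" "\<Omega> \<in> sets (restrict_space borel \<Omega>)" if "a \<in> S" for a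
    using that S \<open>\<Omega> \<in> sets borel\<close> by (auto simp: sets_restrict_space_iff)
  have "w a = 0" if "a \<in> S" for a
  proof -
    have "w a = w a * emeasure (dirac \<Omega> a) {a}"
      using meas[OF that] by (simp add: dirac_def)
    also have "\<dots> \<le> (\<integral>\<^sup>+ a'. w a' * emeasure (dirac \<Omega> a') {a} \<partial>count_space S)"
      using that by (rule nn_integral_ge_point)
    also have "\<dots> = emeasure \<nu> {a}" using w meas[OF that] sets by simp
    also have "\<dots> = 0" using atoms S that by auto
    finally show ?thesis by simp
  qed
  then have "(\<integral>\<^sup>+ a. w a * emeasure (dirac \<Omega> a) \<Omega> \<partial>count_space S) = (\<integral>\<^sup>+ a. 0 \<partial>count_space S)"
    by (intro nn_integral_cong) simp
  moreover have "\<Omega> \<in> sets \<nu>"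
    using \<open>\<Omega> \<in> sets borel\<close> sets by (auto simp: sets_restrict_space_iff)
  ultimately show ?thesis using w by simp
qed

theorem proposition4p9:
  fixes \<kappa> :: real
  assumes "\<kappa> > 0"
  shows "\<exists>(\<Omega> :: (real ^ 'n) set) \<rho>. compact \<Omega> \<and> convex \<Omega> \<and> interior \<Omega> \<noteq> {} \<and>
           \<rho> \<in> prob_measures \<Omega> \<and>
           \<not> (\<exists>\<nu>. hk_optimizer \<Omega> \<kappa> \<rho> \<nu> \<and> discrete_measure \<Omega> \<nu>)"
proof -

  \<comment> \<open>The ball and the root \<open>u\<close> of the potential of the segment\<close>
  obtain b :: "real ^ 'n" where b: "b \<in> Basis" using nonempty_Basis by blast
  note \<kappa> = \<open>\<kappa> > 0\<close>
  \<comment> \<open>Half the length of the segment plus the reach \<open>pi / 2\<close> of the bump: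
    \<open>u\<close> vanishes beyond \<open>R\<close>, so a density proportional to \<open>u\<close>
    fits into the ball.\<close>
  define R :: real where "R = 1 + pi / 2"
  have "R > 0" using pi_gt3 by (simp add: R_def)
  define \<Omega> :: "(real ^ 'n) set" where "\<Omega> = cball 0 (\<kappa> * R)"
  have \<Omega>: "compact \<Omega>" "\<Omega> \<in> sets borel" by (auto simp: \<Omega>_def)
  define C where "C = (\<integral>t. cos_bump t \<partial>lborel)"
  have "C > 0" using integral_cos_bump_pos by (simp add: C_def)
  obtain m where "m > 0" and m: "integrable lborel (\<lambda>t. sqrt (potential (unif_seg m) t))"
    "(\<integral>t. sqrt (potential (unif_seg m) t) \<partial>lborel) = C"
    unfolding C_def by (rule unif_seg_normalization)
  have unif_seg: "finite_measure (unif_seg m)" "sets (unif_seg m) = sets borel" "AE s in unif_seg m. \<bar>s\<bar> \<le> 1"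
    using \<open>m > 0\<close> by (auto simp: sets_unif_seg finite_unif_seg AE_unif_seg)
  have unif_segR: "AE s in unif_seg m. \<bar>s\<bar> \<le> R"
    using unif_seg(3) by eventually_elim (use pi_gt3 in \<open>auto simp: R_def\<close>)
  define u where "u t = sqrt (potential (unif_seg m) t)" for t
  have u0: "0 \<le> u t" and u_sq: "(u t)\<^sup>2 = potential (unif_seg m) t" for t
    by (auto simp: u_def potential_nonneg)
  have u_out: "u t = 0" if "R \<le> \<bar>t\<bar>" for t
    using that potential_eq_0[OF unif_seg(3)] by (simp add: u_def R_def)
  have [measurable]: "u \<in> borel_measurable borel"
    unfolding u_def[abs_def] using potential_facts(1)[OF unif_seg(1,2)] by measurable
  have u_int: "integrable lborel u" "(\<integral>t. u t \<partial>lborel) = C" using m by (auto simp: u_def[abs_def])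
  have unif_seg_mass: "measure (unif_seg m) UNIV = 2 * m"
    using unif_seg_UNIV[of m] \<open>m > 0\<close> by (simp add: measure_def)
  have usq_int: "integrable lborel (\<lambda>t. (u t)\<^sup>2)" "(\<integral>t. (u t)\<^sup>2 \<partial>lborel) = C * (2 * m)"
    using potential_facts(2,3)[OF unif_seg(1,2)] by (auto simp: u_sq C_def unif_seg_mass)

  \<comment> \<open>The probability measure with density \<open>u / C\<close> on the
    diameter\<close>
  define \<sigma> where "\<sigma> = density lborel (\<lambda>t. ennreal (u t / C))"
  have \<sigma>_sets: "sets \<sigma> = sets borel" by (simp add: \<sigma>_def)
  have \<sigma>_UNIV: "emeasure \<sigma> UNIV = 1"
  proof -
    have "emeasure \<sigma> UNIV = (\<integral>\<^sup>+ t. ennreal (u t / C) \<partial>lborel)"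
      unfolding \<sigma>_def by (subst emeasure_density) auto
    also have "\<dots> = ennreal (C / C)"
      using u_int u0 \<open>C > 0\<close> by (subst nn_integral_eq_integral) auto
    finally show ?thesis using \<open>C > 0\<close> by simp
  qed
  have \<sigma>: "finite_measure \<sigma>" "sets \<sigma> = sets borel" "AE t in \<sigma>. \<bar>t\<bar> \<le> R"
  proof -
    show "finite_measure \<sigma>"
      using \<sigma>_UNIV sets_eq_imp_space_eq[OF \<sigma>_sets] by (intro finite_measureI) simp
    show "AE t in \<sigma>. \<bar>t\<bar> \<le> R"
      unfolding \<sigma>_def
    proof (subst AE_density)
      have "\<bar>t\<bar> \<le> R" if "0 < ennreal (u t / C)" for t
        using that u_out[of t] by (cases "\<bar>t\<bar> \<le> R") auto
      then show "AE t in lborel. 0 < ennreal (u t / C) \<longrightarrow> \<bar>t\<bar> \<le> R" by blast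
    qed measurable
  qed (rule \<sigma>_sets)
  define \<rho> where "\<rho> = line_measure \<Omega> \<kappa> b \<sigma>"
  note line_\<sigma> = line_measure[OF b \<kappa> \<sigma>, folded \<Omega>_def, folded \<rho>_def]
  have "\<rho> \<in> prob_measures \<Omega>"
    using line_\<sigma>(1,2) radon_measuresD(2)[OF \<Omega>(1) line_\<sigma>(1)] \<sigma>_UNIV
    by (auto simp: prob_measures_def intro!: prob_spaceI)

  \<comment> \<open>A closed formula for the objective\<close>
  define V where "V \<nu> t = sqrt (\<integral>y. hk_kernel \<kappa> (line_embed \<kappa> b t) y \<partial>\<nu>)"
    for \<nu> :: "(real ^ 'n) measure" and t
  have V: "integrable lborel (\<lambda>t. u t * V \<nu> t)"
    "V \<nu> \<in> borel_measurable borel" "0 \<le> V \<nu> t" "(V \<nu> t)\<^sup>2 = (\<integral>y. hk_kernel \<kappa> (line_embed \<kappa> b t) y \<partial>\<nu>)"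
    "hk_objective \<Omega> \<kappa> \<rho> \<nu> = ennreal (1 + measure \<nu> \<Omega> - 2 / C * (\<integral>t. u t * V \<nu> t \<partial>lborel))"
    "0 \<le> 1 + measure \<nu> \<Omega> - 2 / C * (\<integral>t. u t * V \<nu> t \<partial>lborel)"
    if \<nu>: "\<nu> \<in> radon_measures \<Omega>" for \<nu> t
  proof -
    note K = hk_kernel_integrable[OF \<Omega>(1) \<nu>]
    show V0: "0 \<le> V \<nu> t" for t using K by (simp add: V_def)
    show "(V \<nu> t)\<^sup>2 = (\<integral>y. hk_kernel \<kappa> (line_embed \<kappa> b t) y \<partial>\<nu>)"
      using K by (simp add: V_def)
    show [measurable]: "V \<nu> \<in> borel_measurable borel"
      unfolding V_def[abs_def] using measurable_hk_integral[OF \<Omega>(1) \<nu>] by measurable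
    have V_le: "V \<nu> t \<le> sqrt (measure \<nu> \<Omega>)" for t using K by (simp add: V_def)
    show int: "integrable lborel (\<lambda>t. u t * V \<nu> t)"
    proof (rule Bochner_Integration.integrable_bound)
      show "integrable lborel (\<lambda>t. u t * sqrt (measure \<nu> \<Omega>))" using u_int by simp
      show "AE t in lborel. norm (u t * V \<nu> t) \<le> norm (u t * sqrt (measure \<nu> \<Omega>))"
        using u0 V0 V_le by (intro AE_I2) (auto simp: abs_mult intro!: mult_left_mono)
    qed measurable
    have pos: "0 \<le> 1 + measure \<nu> \<Omega> - 2 * V \<nu> t" for t
      unfolding V_def by (rule HK_sq_dirac_nonneg[OF \<Omega>(1) \<nu>])
    have e: "u t / C * (1 + measure \<nu> \<Omega> - 2 * V \<nu> t)
      = (1 + measure \<nu> \<Omega>) / C * u t - 2 / C * (u t * V \<nu> t)" for t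
      using \<open>C > 0\<close> by (simp add: field_simps)
    have intg: "integrable lborel (\<lambda>t. u t / C * (1 + measure \<nu> \<Omega> - 2 * V \<nu> t))"
      unfolding e using u_int int by simp
    have val: "(\<integral>t. u t / C * (1 + measure \<nu> \<Omega> - 2 * V \<nu> t) \<partial>lborel)
      = 1 + measure \<nu> \<Omega> - 2 / C * (\<integral>t. u t * V \<nu> t \<partial>lborel)"
      unfolding e using u_int int \<open>C > 0\<close> by simp
    have nn: "0 \<le> u t / C * (1 + measure \<nu> \<Omega> - 2 * V \<nu> t)" for t
      using u0 pos \<open>C > 0\<close> by simp
    \<comment> \<open>Because of this sign, inequalities between objectives in
      \<open>ennreal\<close> can be read as inequalities between real numbers.\<close>
    show "0 \<le> 1 + measure \<nu> \<Omega> - 2 / C * (\<integral>t. u t * V \<nu> t \<partial>lborel)"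
      unfolding val[symmetric] using nn by (intro integral_nonneg_AE) auto
    have "hk_objective \<Omega> \<kappa> \<rho> \<nu> = (\<integral>\<^sup>+ t. ennreal (1 + measure \<nu> \<Omega> - 2 * V \<nu> t) \<partial>\<sigma>)"
      using hk_objective_line_measure[OF b \<kappa> \<sigma>, folded \<Omega>_def, OF \<nu>] by (simp add: \<rho>_def V_def)
    also have "\<dots> = (\<integral>\<^sup>+ t. ennreal (u t / C) * ennreal (1 + measure \<nu> \<Omega> - 2 * V \<nu> t) \<partial>lborel)"
      unfolding \<sigma>_def by (subst nn_integral_density) auto
    also have "\<dots> = (\<integral>\<^sup>+ t. ennreal (u t / C * (1 + measure \<nu> \<Omega> - 2 * V \<nu> t)) \<partial>lborel)"
      using u0 pos \<open>C > 0\<close> by (intro nn_integral_cong ennreal_mult[symmetric]) auto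
    also have "\<dots> = ennreal (1 + measure \<nu> \<Omega> - 2 / C * (\<integral>t. u t * V \<nu> t \<partial>lborel))"
      unfolding val[symmetric] by (rule nn_integral_eq_integral[OF intg]) (rule AE_I2[OF nn])
    finally show "hk_objective \<Omega> \<kappa> \<rho> \<nu> = ennreal (1 + measure \<nu> \<Omega> - 2 / C * (\<integral>t. u t * V \<nu> t \<partial>lborel))" .
  qed

  \<comment> \<open>The measure on the segment as competitor\<close>
  define \<nu>0 where "\<nu>0 = line_measure \<Omega> \<kappa> b (unif_seg m)"
  note line_unif_seg = line_measure[OF b \<kappa> unif_seg(1,2) unif_segR, folded \<Omega>_def, folded \<nu>0_def]
  \<comment> \<open>On the diameter the kernel is exactly the bump, so the competitor attains
    equality in \<open>2 * u * V \<le> u\<^sup>2 + V\<^sup>2\<close> at every point.\<close>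
  have V_\<nu>0: "V \<nu>0 t = u t" for t
  proof -
    have "(\<integral>y. hk_kernel \<kappa> (line_embed \<kappa> b t) y \<partial>\<nu>0) = (\<integral>s. hk_kernel \<kappa> (line_embed \<kappa> b t) (line_embed \<kappa> b s) \<partial>unif_seg m)"
      by (rule line_unif_seg(4)) measurable
    then show ?thesis by (simp add: V_def u_def potential_def hk_kernel_line_embed[OF b \<kappa>])
  qed
  have mass_\<nu>0: "measure \<nu>0 \<Omega> = 2 * m"
    using line_unif_seg(2) unif_seg_mass by (simp add: measure_def)

  have False if opt: "hk_optimizer \<Omega> \<kappa> \<rho> \<nu>" and disc: "discrete_measure \<Omega> \<nu>" for \<nu>
  proof -
    have \<nu>: "\<nu> \<in> radon_measures \<Omega>"
      and "hk_objective \<Omega> \<kappa> \<rho> \<nu> = (INF \<nu>'\<in>radon_measures \<Omega>. hk_objective \<Omega> \<kappa> \<rho> \<nu>')"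
      using opt by (auto simp: hk_optimizer_def)
    then have "hk_objective \<Omega> \<kappa> \<rho> \<nu> \<le> hk_objective \<Omega> \<kappa> \<rho> \<nu>0"
      using line_unif_seg(1) by (simp add: INF_lower)
    then have "1 + measure \<nu> \<Omega> - 2 / C * (\<integral>t. u t * V \<nu> t \<partial>lborel)
      \<le> 1 + measure \<nu>0 \<Omega> - 2 / C * (\<integral>t. u t * V \<nu>0 t \<partial>lborel)"
      using V(5,6)[OF \<nu>] V(5,6)[OF line_unif_seg(1)] by simp
    moreover have "(\<integral>t. u t * V \<nu>0 t \<partial>lborel) = C * (2 * m)"
      using usq_int by (simp add: V_\<nu>0 power2_eq_square)
    \<comment> \<open>This reverses the inequality that integrating
      \<open>2 * u * V \<le> u\<^sup>2 + V\<^sup>2\<close> yields for every measure, so equality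
      must hold throughout.\<close>
    ultimately have le: "C * (measure \<nu> \<Omega> + 2 * m) \<le> 2 * (\<integral>t. u t * V \<nu> t \<partial>lborel)"
      using \<open>C > 0\<close> by (simp add: mass_\<nu>0 field_simps)

    \<comment> \<open>Projection of an optimizer to the diameter\<close>
    note \<nu>' = radon_measuresD[OF \<Omega>(1) \<nu>]
    interpret \<nu>: finite_measure \<nu> by fact
    have id[measurable]: "(\<lambda>y. y) \<in> borel_measurable \<nu>"
      using \<nu>'(1) by (rule measurable_restrict_ident)
    define \<pi> where "\<pi> y = (y \<bullet> b) / \<kappa>" for y
    have \<pi>[measurable]: "\<pi> \<in> borel_measurable \<nu>" unfolding \<pi>_def by measurable
    define P where "P = distr \<nu> borel \<pi>"
    have P: "finite_measure P" "sets P = sets borel"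
      unfolding P_def using \<pi> by (auto intro: \<nu>.finite_measure_distr)
    have P_mass: "measure P UNIV = measure \<nu> \<Omega>"
      unfolding P_def using \<pi> \<nu>'(2) by (subst measure_distr) auto
    have P_R: "AE s in P. \<bar>s\<bar> \<le> R"
      unfolding P_def
    proof (subst AE_distr_iff)
      show "AE y in \<nu>. \<bar>\<pi> y\<bar> \<le> R"
      proof (rule AE_I2)
        fix y assume "y \<in> space \<nu>"
        then have "norm y \<le> \<kappa> * R" by (simp add: \<nu>'(2) \<Omega>_def)
        then have "\<bar>y \<bullet> b\<bar> \<le> \<kappa> * R" using Basis_le_norm[OF b, of y] by simp
        then show "\<bar>\<pi> y\<bar> \<le> R" using \<kappa> by (simp add: \<pi>_def pos_divide_le_eq mult.commute)
      qed
    qed auto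
    have pot: "potential P t = (\<integral>y. cos_bump (t - \<pi> y) \<partial>\<nu>)" for t
      unfolding potential_def P_def using \<pi> by (subst integral_distr) auto
    have V_le: "(V \<nu> t)\<^sup>2 \<le> potential P t" for t
      unfolding V(4)[OF \<nu>] pot
    proof (rule integral_mono)
      show "integrable \<nu> (hk_kernel \<kappa> (line_embed \<kappa> b t))"
        by (rule hk_kernel_integrable[OF \<Omega>(1) \<nu>])
      show "integrable \<nu> (\<lambda>y. cos_bump (t - \<pi> y))"
        by (rule \<nu>.integrable_const_bound[where B=1]) (auto simp: cos_bump_bounds)
      show "hk_kernel \<kappa> (line_embed \<kappa> b t) y \<le> cos_bump (t - \<pi> y)" for y
        unfolding \<pi>_def by (rule hk_kernel_le_cos_bump[OF b \<kappa>])
    qed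
    note pot_facts = potential_facts(2,3)[OF P, folded C_def, unfolded P_mass]

    \<comment> \<open>The equality case\<close>
    define v where "v t = (if \<bar>t\<bar> \<le> R then V \<nu> t else 0)" for t
    have uv: "u t * v t = u t * V \<nu> t" for t using u_out[of t] by (auto simp: v_def)
    have v_le: "(v t)\<^sup>2 \<le> potential P t" for t
      using V_le[of t] by (auto simp: v_def potential_nonneg)
    \<comment> \<open>\<open>D\<close> adds the two losses of the estimate: the one from completing
      the square and the one from passing to the projection. Both are non-negative and their total
      integral is at most 0, so both vanish almost everywhere.\<close>
    define D where "D t = (u t - v t)\<^sup>2 + (potential P t - (v t)\<^sup>2)" for t
    have D: "D t = (u t)\<^sup>2 + potential P t - 2 * (u t * V \<nu> t)" for t
      by (simp add: D_def uv[symmetric] power2_diff)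
    have D0: "0 \<le> D t" for t using v_le[of t] by (simp add: D_def)
    have D_int: "integrable lborel D"
      unfolding D using usq_int pot_facts V(1)[OF \<nu>] by simp
    have "(\<integral>t. D t \<partial>lborel) = C * (2 * m) + C * measure \<nu> \<Omega> - 2 * (\<integral>t. u t * V \<nu> t \<partial>lborel)"
      unfolding D using usq_int pot_facts V(1)[OF \<nu>] by simp
    then have "(\<integral>t. D t \<partial>lborel) \<le> 0" using le by (simp add: algebra_simps)
    moreover have "0 \<le> (\<integral>t. D t \<partial>lborel)" using D0 by simp
    ultimately have "(\<integral>t. D t \<partial>lborel) = 0" by (rule antisym)
    then have "AE t in lborel. D t = 0"
      using D_int D0 by (subst integral_nonneg_eq_0_iff_AE[symmetric]) auto
    then have same: "AE t in lborel. potential P t = potential (unif_seg m) t"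
    proof eventually_elim
      case (elim t)
      then have "(u t - v t)\<^sup>2 = 0" "potential P t = (v t)\<^sup>2"
        using v_le[of t] zero_le_power2[of "u t - v t"] unfolding D_def by linarith+
      then show ?case by (simp add: u_sq[symmetric])
    qed

    \<comment> \<open>Absence of atoms and the contradiction\<close>
    have P_1: "AE s in P. \<bar>s\<bar> \<le> 1"
    proof (rule AE_support_of_potential[OF P P_R[unfolded R_def]])
      show "AE t in lborel. 1 + pi / 2 \<le> \<bar>t\<bar> \<longrightarrow> potential P t = 0"
        using same by eventually_elim (simp add: potential_eq_0[OF unif_seg(3)])
    qed
    have no_atom: "measure P {a} = 0" for a
      by (rule no_atom_if_same_potential[OF P P_1 unif_seg unif_seg_interval])
         (use same \<open>m > 0\<close> in \<open>auto simp: potential_def\<close>)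
    have "emeasure \<nu> {a} = 0" if "a \<in> \<Omega>" for a
    proof -
      \<comment> \<open>An atom of \<open>\<nu>\<close> would give its projection an atom at least
        as heavy.\<close>
      have "measure \<nu> {a} \<le> measure \<nu> (\<pi> -` {\<pi> a} \<inter> space \<nu>)"
        using that \<nu>'(2) by (intro \<nu>.finite_measure_mono) (auto intro!: measurable_sets[OF \<pi>])
      also have "\<dots> = measure P {\<pi> a}"
        unfolding P_def using \<pi> by (subst measure_distr) auto
      finally have "measure \<nu> {a} = 0"
        using no_atom[of "\<pi> a"] measure_nonneg[of \<nu> "{a}"] by linarith
      then show ?thesis by (simp add: \<nu>.emeasure_eq_measure)
    qed
    then have "emeasure \<nu> \<Omega> = 0"
      by (rule discrete_measure_eq_0[OF disc \<nu>'(1) \<Omega>(2)])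
    \<comment> \<open>A vanishing measure has potential of integral 0, whereas the potential of the
      segment has integral \<open>2 * m * C > 0\<close>.\<close>
    then have "measure P UNIV = 0" unfolding P_mass by (simp add: measure_def)
    then have "(\<integral>t. potential P t \<partial>lborel) = 0" using potential_facts(3)[OF P] by simp
    moreover have "(\<integral>t. potential P t \<partial>lborel) = (\<integral>t. potential (unif_seg m) t \<partial>lborel)"
      using same potential_facts(1)[OF P] potential_facts(1)[OF unif_seg(1,2)]
      by (intro integral_cong_AE) auto
    ultimately show False
      using usq_int \<open>C > 0\<close> \<open>m > 0\<close> by (simp add: u_sq)
  qed
  moreover have "convex \<Omega>" "interior \<Omega> \<noteq> {}"
    using mult_pos_pos[OF \<kappa> \<open>R > 0\<close>] by (auto simp: \<Omega>_def)
  ultimately show ?thesis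
    using \<Omega>(1) \<open>\<rho> \<in> prob_measures \<Omega>\<close> by blast
qed

end
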